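(* Let $ABC$ be a triangle, and let $\mathcal{K}$ be the Lucas cubic of the medial triangle of $ABC$. Then $\mathcal{K}$ passes through the Lemoine (symmedian) point, the centroid, the circumcenter, the mittenpunkt, the incenter and the orthocenter of $ABC$, through the vertices $A,B,C$, and through the midpoints of the sides of $ABC$.
   Context: The medial triangle of $ABC$ is the triangle whose vertices are the midpoints of the sides of $ABC$. The anticomplementary triangle of a triangle $T$ is the triangle whose medial triangle is $T$. The Lucas cubic of a triangle is the cubic curve passing through its vertices, orthocenter, Gergonne point, centroid, Nagel point, the Lemoine point of its anticomplementary triangle, and the vertices of its anticomplementary triangle (it is the locus of points $P$ such that $P$, its isotomic conjugate, and the Lemoine point of the anticomplementary triangle are collinear). The mittenpunkt of a triangle is the Lemoine point of its excentral triangle (the triangle of its excenters). *)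

theory Defs
  imports "HOL-Analysis.Analysis"
begin

type_synonym point = "real^2"
type_synonym triangle = "point \<times> point \<times> point"

definition line :: "point \<Rightarrow> point \<Rightarrow> point set" where
  "line P Q = affine hull {P, Q}"

definition reflection :: "point set \<Rightarrow> point \<Rightarrow> point" where
  "reflection l P = 2 *\<^sub>R closest_point l P - P"

definition signed_area :: "point \<Rightarrow> point \<Rightarrow> point \<Rightarrow> real" where
  "signed_area P Q R =
     ((Q$1 - P$1) * (R$2 - P$2) - (Q$2 - P$2) * (R$1 - P$1)) / 2"

definition same_side :: "point \<Rightarrow> point \<Rightarrow> point \<Rightarrow> point \<Rightarrow> bool" where
  "same_side P Q X Y \<longleftrightarrow> signed_area P Q X * signed_area P Q Y > 0"

definition opposite_sides :: "point \<Rightarrow> point \<Rightarrow> point \<Rightarrow> point \<Rightarrow> bool" where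
  "opposite_sides P Q X Y \<longleftrightarrow> signed_area P Q X * signed_area P Q Y < 0"

fun medial_triangle :: "triangle \<Rightarrow> triangle" where
  "medial_triangle (A, B, C) = (midpoint B C, midpoint C A, midpoint A B)"

definition anticomplementary_triangle :: "triangle \<Rightarrow> triangle" where
  "anticomplementary_triangle T = (THE T'. medial_triangle T' = T)"

fun centroid :: "triangle \<Rightarrow> point" where
  "centroid (A, B, C) = (1/3) *\<^sub>R (A + B + C)"

fun circumcenter :: "triangle \<Rightarrow> point" where
  "circumcenter (A, B, C) = (THE P. dist P A = dist P B \<and> dist P B = dist P C)"

fun orthocenter :: "triangle \<Rightarrow> point" where
  "orthocenter (A, B, C) =
     (THE P. (P - A) \<bullet> (B - C) = 0 \<and> (P - B) \<bullet> (C - A) = 0 \<and> (P - C) \<bullet> (A - B) = 0)"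

fun equidistant_from_sides :: "triangle \<Rightarrow> point \<Rightarrow> bool" where
  "equidistant_from_sides (A, B, C) P \<longleftrightarrow>
     infdist P (line B C) = infdist P (line C A) \<and>
     infdist P (line C A) = infdist P (line A B)"

fun incenter :: "triangle \<Rightarrow> point" where
  "incenter (A, B, C) =
     (THE P. P \<in> interior (convex hull {A, B, C}) \<and> equidistant_from_sides (A, B, C) P)"

text \<open>The excenter opposite the first vertex; the other two arise by cyclic permutation.\<close>

fun excenter :: "triangle \<Rightarrow> point" where
  "excenter (A, B, C) =
     (THE P. equidistant_from_sides (A, B, C) P \<and>
             opposite_sides B C A P \<and> same_side C A B P \<and> same_side A B C P)"

fun excentral_triangle :: "triangle \<Rightarrow> triangle" where
  "excentral_triangle (A, B, C) = (excenter (A, B, C), excenter (B, C, A), excenter (C, A, B))"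

text \<open>A circle centred at \<open>P\<close> and tangent to a line touches it at the point of the line
  closest to \<open>P\<close>.\<close>

fun gergonne_point :: "triangle \<Rightarrow> point" where
  "gergonne_point (A, B, C) = (let I = incenter (A, B, C) in
     the_elem (line A (closest_point (line B C) I) \<inter>
               line B (closest_point (line C A) I) \<inter>
               line C (closest_point (line A B) I)))"

fun nagel_point :: "triangle \<Rightarrow> point" where
  "nagel_point (A, B, C) =
     the_elem (line A (closest_point (line B C) (excenter (A, B, C))) \<inter>
               line B (closest_point (line C A) (excenter (B, C, A))) \<inter>
               line C (closest_point (line A B) (excenter (C, A, B))))"

text \<open>The symmedian through the first vertex: the median reflected in the bisector of the angle
  at that vertex.\<close>

fun symmedian :: "triangle \<Rightarrow> point set" where
  "symmedian (A, B, C) =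
     reflection (line A (incenter (A, B, C))) ` line A (midpoint B C)"

fun lemoine_point :: "triangle \<Rightarrow> point" where
  "lemoine_point (A, B, C) =
     the_elem (symmedian (A, B, C) \<inter> symmedian (B, C, A) \<inter> symmedian (C, A, B))"

definition mittenpunkt :: "triangle \<Rightarrow> point" where
  "mittenpunkt T = lemoine_point (excentral_triangle T)"

definition cubic_curve :: "point set \<Rightarrow> bool" where
  "cubic_curve K \<longleftrightarrow>
     (\<exists>c :: nat \<Rightarrow> nat \<Rightarrow> real. (\<exists>i\<le>3. c i (3 - i) \<noteq> 0) \<and>
        K = {P. (\<Sum>i\<le>3. \<Sum>j\<le>3 - i. c i j * P$1 ^ i * P$2 ^ j) = 0})"

text \<open>Homogeneous barycentric coordinates. The isotomic conjugate of \<open>x : y : z\<close> is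
  \<open>1/x : 1/y : 1/z\<close>, that is, \<open>yz : zx : xy\<close>. It is kept in homogeneous form because it is a
  point at infinity when \<open>P\<close> lies on the Steiner circumellipse. The second form is the zero
  vector exactly at the vertices, where there is no isotomic conjugate, and it sends the other
  points of a side line to the opposite vertex, as the construction by cevians does.\<close>

fun barycentric :: "triangle \<Rightarrow> point \<Rightarrow> real^3" where
  "barycentric (A, B, C) P =
     vector [signed_area P B C, signed_area P C A, signed_area P A B]"

definition isotomic :: "real^3 \<Rightarrow> real^3" where
  "isotomic v = vector [v$2 * v$3, v$3 * v$1, v$1 * v$2]"

definition projectively_collinear :: "real^3 \<Rightarrow> real^3 \<Rightarrow> real^3 \<Rightarrow> bool" where
  "projectively_collinear u v w \<longleftrightarrow> det (vector [u, v, w] :: real^3^3) = 0"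

fun vertices :: "triangle \<Rightarrow> point set" where
  "vertices (A, B, C) = {A, B, C}"

text \<open>The eleven prescribed points do not determine the cubic when the triangle is isosceles;
  the locus property does.\<close>

definition is_lucas_cubic :: "triangle \<Rightarrow> point set \<Rightarrow> bool" where
  "is_lucas_cubic T K \<longleftrightarrow>
     cubic_curve K \<and>
     vertices T \<union> vertices (anticomplementary_triangle T) \<union>
       {orthocenter T, gergonne_point T, centroid T, nagel_point T,
        lemoine_point (anticomplementary_triangle T)} \<subseteq> K \<and>
     (\<forall>P. P \<notin> vertices T \<longrightarrow>
        (P \<in> K \<longleftrightarrow>
           projectively_collinear (barycentric T P) (isotomic (barycentric T P))
             (barycentric T (lemoine_point (anticomplementary_triangle T)))))"

definition lucas_cubic :: "triangle \<Rightarrow> point set" where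
  "lucas_cubic T = (THE K. is_lucas_cubic T K)"

end

theory Submission
  imports Defs
begin

text \<open>Let \<open>x : y : z\<close> be barycentric coordinates with respect to the medial triangle and let
  \<open>p : q : r\<close>, with \<open>p = b\<^sup>2 + c\<^sup>2 - a\<^sup>2\<close> and cyclically, be those of the Lemoine point of
  \<open>ABC\<close>. The Lucas cubic is then
  \<open>p x (y\<^sup>2 - z\<^sup>2) + q y (z\<^sup>2 - x\<^sup>2) + r z (x\<^sup>2 - y\<^sup>2) = 0\<close>, because the locus property
  prescribes it outside the vertices. On the line at infinity this form does not vanish
  identically, since \<open>q + r = 2 a\<^sup>2\<close>. All centers have explicit weights in the side lengths:
  the circumcenter, incenter and mittenpunkt of \<open>ABC\<close> are the orthocenter, Nagel and Gergonne point
  of the medial triangle, and the weights of the mittenpunkt come from the fact that the squared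
  sides of the excentral triangle are proportional to \<open>a (b + c - a)\<close> and cyclically. What
  remains are polynomial identities.\<close>

section \<open>Barycentric coordinates\<close>

fun bary_point :: "triangle \<Rightarrow> real \<Rightarrow> real \<Rightarrow> real \<Rightarrow> point" where
  "bary_point (A, B, C) u v w = (1 / (u + v + w)) *\<^sub>R (u *\<^sub>R A + v *\<^sub>R B + w *\<^sub>R C)"

lemma bary_point_rotate: "bary_point (B, C, A) v w u = bary_point (A, B, C) u v w"
  by (simp add: algebra_simps)

text \<open>Weights are homogeneous, so common factors of explicit weights can be cleared. If the
  weights sum to zero, both sides are the zero vector because \<open>1 / 0 = 0\<close>.\<close>

lemma bary_point_scale:
  assumes "k \<noteq> 0"
  shows "bary_point T (k * u) (k * v) (k * w) = bary_point T u v w"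
proof (cases T)
  case (fields A B C)
  have "(k * u) *\<^sub>R A + (k * v) *\<^sub>R B + (k * w) *\<^sub>R C = k *\<^sub>R (u *\<^sub>R A + v *\<^sub>R B + w *\<^sub>R C)"
    by (simp add: scaleR_right_distrib)
  then show ?thesis
    using assms unfolding fields bary_point.simps distrib_left[symmetric] by simp
qed

lemma bary_point_nth:
  assumes "u + v + w \<noteq> 0"
  shows "(u + v + w) * bary_point (A, B, C) u v w $ i = u * A $ i + v * B $ i + w * C $ i"
  using assms by simp

section \<open>Signed areas as barycentric coordinates\<close>

lemma double_signed_area:
  "2 * signed_area P Q R = (Q$1 - P$1) * (R$2 - P$2) - (Q$2 - P$2) * (R$1 - P$1)"
  by (simp add: signed_area_def)

lemma signed_area_rotate: "signed_area B C A = signed_area A B C"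
  by (simp add: signed_area_def algebra_simps)

text \<open>Collinearity is the equality case of Cauchy-Schwarz. By Lagrange's identity the gap in
  the squared inequality is the square of the doubled signed area.\<close>

lemma collinear_iff_signed_area: "collinear {A, B, C} \<longleftrightarrow> signed_area A B C = 0"
proof -
  let ?x = "A - B" and ?y = "C - B"
  have "collinear {A, B, C} \<longleftrightarrow> \<bar>?x \<bullet> ?y\<bar> = \<bar>norm ?x * norm ?y\<bar>"
    by (simp add: collinear_3 norm_cauchy_schwarz_equal)
  also have "\<dots> \<longleftrightarrow> (?x \<bullet> ?y)\<^sup>2 = (?x \<bullet> ?x) * (?y \<bullet> ?y)"
    by (simp only: abs_eq_iff power2_eq_iff[symmetric] power_mult_distrib power2_norm_eq_inner)
  also have "\<dots> \<longleftrightarrow> (?x \<bullet> ?x) * (?y \<bullet> ?y) - (?x \<bullet> ?y)\<^sup>2 = 0"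
    by auto
  also have "(?x \<bullet> ?x) * (?y \<bullet> ?y) - (?x \<bullet> ?y)\<^sup>2 = (2 * signed_area A B C)\<^sup>2"
    unfolding inner_vec_def sum_2 inner_real_def vector_minus_component double_signed_area
    by (simp add: power2_eq_square algebra_simps)
  finally show ?thesis by simp
qed

text \<open>The area is affine in the moving vertex, and the contributions of \<open>B\<close> and
  \<open>C\<close> vanish. The proof multiplies by the weight sum to stay polynomial.\<close>

lemma signed_area_bary_point:
  assumes "u + v + w \<noteq> 0"
  shows "signed_area (bary_point (A, B, C) u v w) B C = u / (u + v + w) * signed_area A B C"
proof -
  let ?P = "bary_point (A, B, C) u v w"
  have "(u + v + w) * (2 * signed_area ?P B C) =
      ((u + v + w) * ?P$1) * (B$2 - C$2) + ((u + v + w) * ?P$2) * (C$1 - B$1)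
      + (u + v + w) * (B$1 * C$2 - B$2 * C$1)"
    unfolding double_signed_area by (simp add: algebra_simps del: bary_point.simps)
  also have "\<dots> = u * (2 * signed_area A B C)"
    unfolding bary_point_nth[OF assms] double_signed_area by (simp add: algebra_simps)
  finally show ?thesis using assms by (simp add: field_simps del: bary_point.simps)
qed

lemma signed_areas_bary_point:
  assumes "u + v + w \<noteq> 0"
  shows "signed_area (bary_point (A, B, C) u v w) B C = u / (u + v + w) * signed_area A B C"
    "signed_area (bary_point (A, B, C) u v w) C A = v / (u + v + w) * signed_area A B C"
    "signed_area (bary_point (A, B, C) u v w) A B = w / (u + v + w) * signed_area A B C"
proof -
  have rot: "bary_point (B, C, A) v w u = bary_point (A, B, C) u v w"
    "bary_point (C, A, B) w u v = bary_point (A, B, C) u v w"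
    "signed_area C A B = signed_area A B C" "signed_area B C A = signed_area A B C"
    by (simp_all only: bary_point_rotate[of B C A] bary_point_rotate[of C A B]
        signed_area_rotate[of C A B] signed_area_rotate[of B C A])
  have sums: "v + w + u = u + v + w" "w + u + v = u + v + w" by simp_all
  show "signed_area (bary_point (A, B, C) u v w) B C = u / (u + v + w) * signed_area A B C"
    "signed_area (bary_point (A, B, C) u v w) C A = v / (u + v + w) * signed_area A B C"
    "signed_area (bary_point (A, B, C) u v w) A B = w / (u + v + w) * signed_area A B C"
    using assms signed_area_bary_point[of u v w A B C] signed_area_bary_point[of v w u B C A]
      signed_area_bary_point[of w u v C A B]
    unfolding rot sums by blast+
qed

lemma barycentric_bary_point:
  assumes "u + v + w \<noteq> 0"
  shows "barycentric (A, B, C) (bary_point (A, B, C) u v w) =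
    (signed_area A B C / (u + v + w)) *\<^sub>R vector [u, v, w]"
  using signed_areas_bary_point[OF assms, of A B C]
  by (simp add: vec_eq_iff forall_3 vector_3 del: bary_point.simps)

lemma signed_area_sum:
  "signed_area P B C + signed_area P C A + signed_area P A B = signed_area A B C"
  unfolding signed_area_def by (simp add: field_simps)

text \<open>Converse direction: an arbitrary point receives weights. This feeds the uniqueness part
  of the excenter description.\<close>

lemma bary_point_signed_areas:
  assumes "signed_area A B C \<noteq> 0"
  shows "P = bary_point (A, B, C) (signed_area P B C) (signed_area P C A) (signed_area P A B)"
proof -
  have "signed_area A B C * P $ i =
      signed_area P B C * A $ i + signed_area P C A * B $ i + signed_area P A B * C $ i" for i
    using exhaust_2[of i] by (auto simp: signed_area_def field_simps)
  then have "signed_area A B C *\<^sub>R P =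
      signed_area P B C *\<^sub>R A + signed_area P C A *\<^sub>R B + signed_area P A B *\<^sub>R C"
    by (simp add: vec_eq_iff)
  then have "P = (1 / signed_area A B C) *\<^sub>R
      (signed_area P B C *\<^sub>R A + signed_area P C A *\<^sub>R B + signed_area P A B *\<^sub>R C)"
    using assms by (metis divide_self_if scaleR_one scaleR_scaleR times_divide_eq_left mult_1)
  then show ?thesis by (simp only: bary_point.simps signed_area_sum)
qed

section \<open>Lines and perpendiculars\<close>

lemma line_alt: "line P Q = range (\<lambda>t. P + t *\<^sub>R (Q - P))"
  by (simp add: line_def affine_hull_2_alt)

lemma line_scale:
  assumes "k \<noteq> 0" "Q - P = k *\<^sub>R (R - P)"
  shows "line P Q = line P R"
proof -
  have "P + t *\<^sub>R (R - P) = P + (t / k) *\<^sub>R (Q - P)" for t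
    using assms by simp
  moreover have "P + t *\<^sub>R (Q - P) = P + (t * k) *\<^sub>R (R - P)" for t
    using assms by simp
  ultimately show ?thesis unfolding line_alt by (blast intro: rangeI)
qed

lemma bary_point_minus_vertex:
  assumes "u + v + w \<noteq> 0"
  shows "bary_point (A, B, C) u v w - A =
    (1 / (u + v + w)) *\<^sub>R (v *\<^sub>R (B - A) + w *\<^sub>R (C - A))"
proof -
  have "A = (1 / (u + v + w)) *\<^sub>R ((u + v + w) *\<^sub>R A)"
    using assms by simp
  then have "bary_point (A, B, C) u v w - A =
      (1 / (u + v + w)) *\<^sub>R (u *\<^sub>R A + v *\<^sub>R B + w *\<^sub>R C - (u + v + w) *\<^sub>R A)"
    unfolding bary_point.simps by (metis scaleR_diff_right)
  also have "u *\<^sub>R A + v *\<^sub>R B + w *\<^sub>R C - (u + v + w) *\<^sub>R A = v *\<^sub>R (B - A) + w *\<^sub>R (C - A)"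
    by (simp add: algebra_simps)
  finally show ?thesis .
qed

text \<open>A cevian from \<open>A\<close> depends only on the ratio of the other two weights:
  changing \<open>u\<close> rescales the vector from \<open>A\<close>.\<close>

lemma line_bary_point:
  assumes "u + v + w \<noteq> 0" "u' + v + w \<noteq> 0"
  shows "line A (bary_point (A, B, C) u v w) = line A (bary_point (A, B, C) u' v w)"
proof (rule line_scale)
  show "(u' + v + w) / (u + v + w) \<noteq> 0" using assms by simp
  show "bary_point (A, B, C) u v w - A =
      ((u' + v + w) / (u + v + w)) *\<^sub>R (bary_point (A, B, C) u' v w - A)"
    unfolding bary_point_minus_vertex[OF assms(1)] bary_point_minus_vertex[OF assms(2)]
    using assms(2) by (simp del: scaleR_right_distrib)
qed

text \<open>Along \<open>line P R\<close> the area against \<open>Q R\<close> falls off linearly as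
  \<open>1 - s\<close>, so it vanishes only at \<open>R\<close>.\<close>

lemma line_Int_line:
  assumes "signed_area P Q R \<noteq> 0"
  shows "line P R \<inter> line Q R = {R}"
proof -
  have "X = R" if "X \<in> line P R" "X \<in> line Q R" for X
  proof -
    obtain s where s: "X = P + s *\<^sub>R (R - P)"
      using \<open>X \<in> line P R\<close> by (auto simp: line_alt)
    obtain t where t: "X = Q + t *\<^sub>R (R - Q)"
      using \<open>X \<in> line Q R\<close> by (auto simp: line_alt)
    have "signed_area X Q R = 0"
      unfolding t signed_area_def by (simp add: algebra_simps)
    moreover have "signed_area X Q R = (1 - s) * signed_area P Q R"
      unfolding s signed_area_def by (simp add: field_simps)
    ultimately show ?thesis using assms s by simp
  qed
  moreover have "R \<in> line P R" for P unfolding line_def by (simp add: hull_inc)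
  ultimately show ?thesis by blast
qed

text \<open>\<open>w \<noteq> 0\<close> places \<open>P\<close> off the line \<open>AB\<close>, so
  the cevians from \<open>A\<close> and \<open>B\<close> already meet in \<open>P\<close> alone, and
  the third one contains \<open>P\<close>.\<close>

lemma the_elem_cevians:
  assumes "signed_area A B C \<noteq> 0" "u + v + w \<noteq> 0" "w \<noteq> 0"
    and "P = bary_point (A, B, C) u v w"
  shows "the_elem (line A P \<inter> line B P \<inter> line C P) = P"
proof -
  have "signed_area P A B = w / (u + v + w) * signed_area A B C"
    using signed_areas_bary_point(3)[OF assms(2)] assms(4) by simp
  then have "signed_area A B P \<noteq> 0" using assms by (simp add: signed_area_rotate)
  then have "line A P \<inter> line B P \<inter> line C P = {P}"
    using line_Int_line[of A B P] by (auto simp: line_def hull_inc)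
  then show ?thesis by simp
qed

text \<open>Pythagoras for the right angle at the foot \<open>Q\<close>; a point of the line
  satisfying orthogonality is therefore both the nearest point and the one realizing the
  distance.\<close>

lemma closest_point_line:
  assumes "Q \<in> line B C" "(P - Q) \<bullet> (C - B) = 0"
  shows "closest_point (line B C) P = Q" "infdist P (line B C) = dist P Q"
proof -
  obtain s where s: "Q = B + s *\<^sub>R (C - B)" using assms(1) by (auto simp: line_alt)
  have le: "dist P Q \<le> dist P X" if "X \<in> line B C" for X
  proof -
    obtain t where t: "X = B + t *\<^sub>R (C - B)" using \<open>X \<in> line B C\<close> by (auto simp: line_alt)
    have "X - Q = (t - s) *\<^sub>R (C - B)" unfolding s t by (simp add: algebra_simps)
    then have "orthogonal (P - Q) (X - Q)" using assms(2) by (simp add: orthogonal_def)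
    then have "(norm ((P - Q) + - (X - Q)))\<^sup>2 = (norm (P - Q))\<^sup>2 + (norm (- (X - Q)))\<^sup>2"
      by (intro norm_add_Pythagorean) (simp only: orthogonal_def inner_minus_right neg_equal_0_iff_equal)
    then have "(dist P Q)\<^sup>2 \<le> (dist P X)\<^sup>2" by (simp add: dist_norm)
    then show ?thesis by (simp add: power_mono_iff)
  qed
  have aff: "affine (line B C)" by (simp add: line_def affine_affine_hull)
  then show "closest_point (line B C) P = Q"
    using closest_point_unique[OF affine_imp_convex _ assms(1), of P] le
    by (metis affine_closed)
  show "infdist P (line B C) = dist P Q"
    using le assms(1) by (intro antisym infdist_le) (auto simp: infdist_def intro!: cINF_greatest)
qed

lemma foot_exists:
  fixes P :: point
  assumes "B \<noteq> C"
  obtains Q where "Q \<in> line B C" "(P - Q) \<bullet> (C - B) = 0"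
proof
  let ?Q = "B + ((P - B) \<bullet> (C - B) / ((C - B) \<bullet> (C - B))) *\<^sub>R (C - B)"
  show "?Q \<in> line B C" by (auto simp: line_alt)
  have "(P - ?Q) \<bullet> (C - B) = (P - B) \<bullet> (C - B) - (P - B) \<bullet> (C - B) / ((C - B) \<bullet> (C - B)) * ((C - B) \<bullet> (C - B))"
    by (simp only: diff_diff_add[symmetric] inner_diff_left[of "P - B"] inner_scaleR_left)
  then show "(P - ?Q) \<bullet> (C - B) = 0" using assms by simp
qed

text \<open>Area is half of base times height, solved for the height.\<close>

lemma infdist_line:
  assumes "B \<noteq> C"
  shows "infdist P (line B C) = 2 * \<bar>signed_area P B C\<bar> / dist B C"
proof -
  obtain Q where Q: "Q \<in> line B C" "(P - Q) \<bullet> (C - B) = 0"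
    using foot_exists[OF assms] .
  obtain s where s: "Q = B + s *\<^sub>R (C - B)" using Q(1) by (auto simp: line_alt)
  have area: "2 * signed_area P B C = (C$1 - B$1) * (P - Q)$2 - (C$2 - B$2) * (P - Q)$1"
    unfolding double_signed_area s by (simp add: field_simps)
  have perp: "(P - Q)$1 * (C$1 - B$1) + (P - Q)$2 * (C$2 - B$2) = 0"
    using Q(2) by (simp add: inner_vec_def sum_2)
  \<comment> \<open>Lagrange's identity again: \<open>perp\<close> removes the inner product,
    leaving the squared cross product. Squaring avoids deciding the orientation.\<close>
  have "(dist P Q * dist B C)\<^sup>2 = (2 * signed_area P B C)\<^sup>2"
    unfolding area power_mult_distrib dist_norm power2_norm_eq_inner norm_minus_commute[of B C]
      inner_vec_def sum_2 inner_real_def vector_minus_component[of C B]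
    using perp by algebra
  then have "\<bar>dist P Q * dist B C\<bar> = \<bar>2 * signed_area P B C\<bar>"
    by (simp only: power2_eq_iff abs_eq_iff)
  then show ?thesis using assms closest_point_line(2)[OF Q] by (simp add: field_simps abs_mult)
qed

section \<open>Squared distances, Heron's formula and strict triangle inequalities\<close>

lemma power2_dist:
  fixes P Q :: point
  shows "(dist P Q)\<^sup>2 = (P$1 - Q$1)\<^sup>2 + (P$2 - Q$2)\<^sup>2"
  unfolding dist_norm power2_norm_eq_inner inner_vec_def sum_2 by (simp add: power2_eq_square)

lemma heron:
  "(dist B C + dist C A + dist A B) * (- dist B C + dist C A + dist A B) *
   (dist B C - dist C A + dist A B) * (dist B C + dist C A - dist A B) = 16 * (signed_area A B C)\<^sup>2"
proof -
  define a b c where "a = dist B C" and "b = dist C A" and "c = dist A B"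
  \<comment> \<open>Expanded, the product contains only squared lengths, which are polynomials in
    the coordinates.\<close>
  have "(a + b + c) * (- a + b + c) * (a - b + c) * (a + b - c) =
      2 * (a\<^sup>2 * b\<^sup>2 + b\<^sup>2 * c\<^sup>2 + c\<^sup>2 * a\<^sup>2) - (a\<^sup>2)\<^sup>2 - (b\<^sup>2)\<^sup>2 - (c\<^sup>2)\<^sup>2"
    by algebra
  also have "\<dots> = 4 * (2 * signed_area A B C)\<^sup>2"
    unfolding a_def b_def c_def power2_dist double_signed_area
    by (simp add: power2_eq_square algebra_simps)
  finally show ?thesis unfolding a_def b_def c_def by simp
qed

text \<open>Equality in a triangle inequality would make a factor in Heron's formula vanish, hence
  the area as well.\<close>

lemma triangle_ineqs:
  assumes "signed_area A B C \<noteq> 0"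
  shows "dist B C > 0" "dist C A > 0" "dist A B > 0"
    "dist B C < dist C A + dist A B" "dist C A < dist B C + dist A B" "dist A B < dist B C + dist C A"
proof -
  show "dist B C > 0" "dist C A > 0" "dist A B > 0"
    using assms by (auto simp: signed_area_def)
  have "dist B C \<noteq> dist C A + dist A B" "dist C A \<noteq> dist B C + dist A B" "dist A B \<noteq> dist B C + dist C A"
    using heron[of B C A] assms by auto
  moreover have "dist B C \<le> dist C A + dist A B" "dist C A \<le> dist B C + dist A B" "dist A B \<le> dist B C + dist C A"
    using dist_triangle[of B C A] dist_triangle[of C A B] dist_triangle[of A B C]
    by (simp_all add: dist_commute add.commute)
  ultimately show "dist B C < dist C A + dist A B" "dist C A < dist B C + dist A B" "dist A B < dist B C + dist C A"
    by linarith+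
qed

declare bary_point.simps [simp del]

section \<open>Incenter and excenters\<close>

text \<open>The distance to a side is the absolute weight divided by the side length, up to the
  factor \<open>k\<close> common to all three sides.\<close>

lemma equidistant_bary_point:
  assumes "signed_area A B C \<noteq> 0" "u + v + w \<noteq> 0"
  shows "equidistant_from_sides (A, B, C) (bary_point (A, B, C) u v w) \<longleftrightarrow>
    \<bar>u / dist B C\<bar> = \<bar>v / dist C A\<bar> \<and> \<bar>v / dist C A\<bar> = \<bar>w / dist A B\<bar>"
proof -
  define k where "k = 2 * \<bar>signed_area A B C / (u + v + w)\<bar>"
  have k: "k \<noteq> 0" using assms by (simp add: k_def)
  have *: "2 * \<bar>t / (u + v + w) * signed_area A B C\<bar> / r = k * (\<bar>t\<bar> / r)" for t r
    unfolding k_def by (simp add: abs_mult)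
  have ne: "B \<noteq> C" "C \<noteq> A" "A \<noteq> B"
    using triangle_ineqs(1-3)[OF assms(1)] by auto
  show ?thesis
    by (simp only: equidistant_from_sides.simps infdist_line[OF ne(1)] infdist_line[OF ne(2)]
        infdist_line[OF ne(3)] signed_areas_bary_point[OF assms(2)] * mult_cancel_left k abs_divide abs_of_nonneg zero_le_dist) simp
qed

lemma eq_of_abs_eq:
  fixes x y :: real
  assumes "\<bar>x\<bar> = \<bar>y\<bar>"
  shows "0 < x * y \<Longrightarrow> x = y" "x * y < 0 \<Longrightarrow> x = - y"
  using assms by (auto simp: abs_eq_iff)

text \<open>Interior points are those with positive weights. The absolute values in the equidistance
  condition then drop and the weights are proportional to the sides.\<close>

lemma incenter_eq:
  assumes "signed_area A B C \<noteq> 0"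
  shows "incenter (A, B, C) = bary_point (A, B, C) (dist B C) (dist C A) (dist A B)"
  unfolding incenter.simps
proof (rule the_equality, intro conjI)
  note sides = triangle_ineqs[OF assms]
  let ?a = "dist B C" and ?b = "dist C A" and ?c = "dist A B"
  have hull: "interior (convex hull {A, B, C}) =
      {P. \<exists>x y z. 0 < x \<and> 0 < y \<and> 0 < z \<and> x + y + z = 1 \<and> x *\<^sub>R A + y *\<^sub>R B + z *\<^sub>R C = P}"
    using assms by (intro interior_convex_hull_3_minimal) (simp_all add: collinear_iff_signed_area)
  have s: "?a + ?b + ?c > 0" using sides by linarith
  show "bary_point (A, B, C) ?a ?b ?c \<in> interior (convex hull {A, B, C})"
    unfolding hull mem_Collect_eq
  proof (intro exI conjI)
    show "(?a / (?a + ?b + ?c)) *\<^sub>R A + (?b / (?a + ?b + ?c)) *\<^sub>R B + (?c / (?a + ?b + ?c)) *\<^sub>R C =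
        bary_point (A, B, C) ?a ?b ?c"
      by (simp add: bary_point.simps scaleR_right_distrib)
    show "?a / (?a + ?b + ?c) + ?b / (?a + ?b + ?c) + ?c / (?a + ?b + ?c) = 1"
      using s by (simp flip: add_divide_distrib)
  qed (use sides s in simp_all)
  show "equidistant_from_sides (A, B, C) (bary_point (A, B, C) ?a ?b ?c)"
    using sides s by (subst equidistant_bary_point[OF assms]) auto
  fix P assume P: "P \<in> interior (convex hull {A, B, C}) \<and> equidistant_from_sides (A, B, C) P"
  then obtain x y z where pos: "0 < x" "0 < y" "0 < z" and sum: "x + y + z = 1"
    and "P = x *\<^sub>R A + y *\<^sub>R B + z *\<^sub>R C"
    unfolding hull by auto
  then have P_eq: "P = bary_point (A, B, C) x y z" by (simp add: bary_point.simps)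
  have "\<bar>x / ?a\<bar> = \<bar>y / ?b\<bar> \<and> \<bar>y / ?b\<bar> = \<bar>z / ?c\<bar>"
    using P equidistant_bary_point[OF assms, of x y z] sum unfolding P_eq by simp
  then have eq: "y / ?b = x / ?a" "z / ?c = x / ?a" using pos by simp_all
  have "P = bary_point (A, B, C) (x / ?a * ?a) (y / ?b * ?b) (z / ?c * ?c)"
    unfolding P_eq using sides by simp
  also have "\<dots> = bary_point (A, B, C) ?a ?b ?c"
    unfolding eq using sides pos by (intro bary_point_scale) simp
  finally show "P = bary_point (A, B, C) ?a ?b ?c" .
qed

lemma excenter_eq:
  assumes "signed_area A B C \<noteq> 0"
  shows "excenter (A, B, C) = bary_point (A, B, C) (- dist B C) (dist C A) (dist A B)"
  unfolding excenter.simps opposite_sides_def same_side_def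
proof (rule the_equality, intro conjI)
  note sides = triangle_ineqs[OF assms]
  let ?a = "dist B C" and ?b = "dist C A" and ?c = "dist A B" and ?S = "signed_area A B C"
  let ?J = "bary_point (A, B, C) (- ?a) ?b ?c"
  have s: "- ?a + ?b + ?c > 0" using sides by linarith
  have rot: "signed_area B C P = signed_area P B C" "signed_area C A P = signed_area P C A"
    "signed_area A B P = signed_area P A B" for P
    by (simp_all only: signed_area_rotate[of B C P] signed_area_rotate[of C A P] signed_area_rotate[of A B P])
  have S: "signed_area B C A = ?S" "signed_area C A B = ?S"
    by (simp_all only: signed_area_rotate[of C A B] signed_area_rotate[of B C A])
  \<comment> \<open>Each side condition reduces to the sign of a weight, the other factor being
    positive by \<open>q\<close>.\<close>
  have prod: "?S * (t / (- ?a + ?b + ?c) * ?S) = t * (?S\<^sup>2 / (- ?a + ?b + ?c))" for t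
    by (simp add: power2_eq_square)
  have q: "?S\<^sup>2 / (- ?a + ?b + ?c) > 0" using assms s by simp
  have area: "signed_area ?J B C = - ?a / (- ?a + ?b + ?c) * ?S"
    "signed_area ?J C A = ?b / (- ?a + ?b + ?c) * ?S"
    "signed_area ?J A B = ?c / (- ?a + ?b + ?c) * ?S"
    by (rule signed_areas_bary_point; use s in linarith)+
  show "equidistant_from_sides (A, B, C) ?J"
    using sides s by (subst equidistant_bary_point[OF assms]) auto
  show "signed_area B C A * signed_area B C ?J < 0"
    unfolding rot(1)[of ?J] S area prod using q sides by (simp only: mult_less_0_iff) simp
  show "signed_area C A B * signed_area C A ?J > 0" "signed_area A B C * signed_area A B ?J > 0"
    unfolding rot(2,3)[of ?J] S area prod using q sides by (simp_all only: mult_pos_pos)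
  fix P
  \<comment> \<open>The areas themselves serve as weights of the competitor, so the side conditions
    give their signs relative to \<open>?S\<close>. Those signs decide the absolute values up to
    proportionality.\<close>
  define u v w where "u = signed_area P B C" and "v = signed_area P C A" and "w = signed_area P A B"
  assume P: "equidistant_from_sides (A, B, C) P \<and> signed_area B C A * signed_area B C P < 0 \<and>
      signed_area C A B * signed_area C A P > 0 \<and> signed_area A B C * signed_area A B P > 0"
  have P_eq: "P = bary_point (A, B, C) u v w"
    unfolding u_def v_def w_def by (rule bary_point_signed_areas[OF assms])
  have sum: "u + v + w = ?S" unfolding u_def v_def w_def by (rule signed_area_sum)
  have signs: "?S * u < 0" "?S * v > 0" "?S * w > 0"
    using P unfolding rot[of P] S u_def v_def w_def by simp_all
  have eq: "\<bar>u / ?a\<bar> = \<bar>v / ?b\<bar>" "\<bar>w / ?c\<bar> = \<bar>v / ?b\<bar>"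
    using P equidistant_bary_point[OF assms, of u v w] sum assms unfolding P_eq by simp_all
  have "v \<noteq> 0" using signs by auto
  have "u / ?a * (v / ?b) < 0" "0 < w / ?c * (v / ?b)"
    using signs sides by (auto simp: zero_less_mult_iff mult_less_0_iff divide_less_0_iff zero_less_divide_iff)
  then have eq: "u / ?a = - (v / ?b)" "w / ?c = v / ?b"
    using eq eq_of_abs_eq by blast+
  have "P = bary_point (A, B, C) (u / ?a * ?a) (v / ?b * ?b) (w / ?c * ?c)"
    unfolding P_eq using sides by simp
  also have "\<dots> = bary_point (A, B, C) (v / ?b * - ?a) (v / ?b * ?b) (v / ?b * ?c)"
    unfolding eq by simp
  also have "\<dots> = ?J"
    using sides \<open>v \<noteq> 0\<close> by (intro bary_point_scale) simp
  finally show "P = ?J" .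
qed

section \<open>Feet of perpendiculars and points of tangency\<close>

lemma inner_sides:
  fixes A B C :: point
  shows "(B - A) \<bullet> (B - A) = (dist A B)\<^sup>2" "(C - A) \<bullet> (C - A) = (dist C A)\<^sup>2"
    "(B - A) \<bullet> (C - A) = ((dist C A)\<^sup>2 + (dist A B)\<^sup>2 - (dist B C)\<^sup>2) / 2"
  by (simp_all add: dist_norm power2_norm_eq_inner inner_diff_left inner_diff_right inner_commute)

lemma inner_bary_point:
  assumes "u + v + w \<noteq> 0"
  shows "(bary_point (A, B, C) u v w - A) \<bullet> (C - B) =
    (w * ((dist B C)\<^sup>2 + (dist C A)\<^sup>2 - (dist A B)\<^sup>2) - v * ((dist A B)\<^sup>2 + (dist B C)\<^sup>2 - (dist C A)\<^sup>2))
      / (2 * (u + v + w))"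
proof -
  have "C - B = (C - A) - (B - A)" by simp
  then have "(v *\<^sub>R (B - A) + w *\<^sub>R (C - A)) \<bullet> (C - B) =
      v * ((B - A) \<bullet> (C - A)) - v * ((B - A) \<bullet> (B - A)) + w * ((C - A) \<bullet> (C - A)) - w * ((B - A) \<bullet> (C - A))"
    by (simp only: inner_add_left inner_scaleR_left inner_diff_right inner_commute[of "C - A" "B - A"])
      (simp add: algebra_simps inner_commute)
  also have "\<dots> = (w * ((dist B C)\<^sup>2 + (dist C A)\<^sup>2 - (dist A B)\<^sup>2)
      - v * ((dist A B)\<^sup>2 + (dist B C)\<^sup>2 - (dist C A)\<^sup>2)) / 2"
    unfolding inner_sides by (simp add: field_simps dist_commute)
  finally have "(v *\<^sub>R (B - A) + w *\<^sub>R (C - A)) \<bullet> (C - B) = \<dots>" .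
  then show ?thesis
    unfolding bary_point_minus_vertex[OF assms] inner_scaleR_left by (simp only:) simp
qed

text \<open>The last hypothesis is the cross-multiplied equality of the components of both points
  along \<open>BC\<close>, as computed in \<open>inner_bary_point\<close>.\<close>

lemma closest_point_bary_point:
  assumes "u + v + w \<noteq> 0" "v' + w' \<noteq> 0"
    and "(w * ((dist B C)\<^sup>2 + (dist C A)\<^sup>2 - (dist A B)\<^sup>2)
           - v * ((dist A B)\<^sup>2 + (dist B C)\<^sup>2 - (dist C A)\<^sup>2)) * (v' + w') =
         (w' * ((dist B C)\<^sup>2 + (dist C A)\<^sup>2 - (dist A B)\<^sup>2)
           - v' * ((dist A B)\<^sup>2 + (dist B C)\<^sup>2 - (dist C A)\<^sup>2)) * (u + v + w)"
  shows "closest_point (line B C) (bary_point (A, B, C) u v w) = bary_point (A, B, C) 0 v' w'"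
proof (rule closest_point_line(1))
  let ?P = "bary_point (A, B, C) u v w" and ?Q = "bary_point (A, B, C) 0 v' w'"
  have s: "0 + v' + w' \<noteq> 0" using assms(2) by simp
  have "B = (1 / (v' + w')) *\<^sub>R ((v' + w') *\<^sub>R B)" using assms(2) by simp
  then have "?Q = B + (w' / (v' + w')) *\<^sub>R (C - B)"
    by (simp add: bary_point.simps algebra_simps)
  then show "?Q \<in> line B C" by (auto simp: line_alt)
  have "(?P - ?Q) \<bullet> (C - B) = (?P - A) \<bullet> (C - B) - (?Q - A) \<bullet> (C - B)"
    by (simp flip: inner_diff_left)
  moreover have "x / (2 * (u + v + w)) = y / (2 * (0 + v' + w'))"
    if "x * (v' + w') = y * (u + v + w)" for x y
    using that assms(1,2) by (subst frac_eq_eq) (simp_all add: algebra_simps)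
  ultimately show "(?P - ?Q) \<bullet> (C - B) = 0"
    unfolding inner_bary_point[OF assms(1)] inner_bary_point[OF s] using assms(3) by simp
qed

text \<open>The incircle divides \<open>BC\<close> into tangent lengths \<open>s - b\<close> and
  \<open>s - c\<close>, with \<open>s\<close> the semiperimeter; the weights are these lengths
  doubled, each attached to the far endpoint.\<close>

lemma closest_point_incenter:
  assumes "signed_area A B C \<noteq> 0"
  shows "closest_point (line B C) (incenter (A, B, C)) =
    bary_point (A, B, C) 0 (dist B C + dist C A - dist A B) (dist A B + dist B C - dist C A)"
  unfolding incenter_eq[OF assms]
proof (rule closest_point_bary_point)
  note sides = triangle_ineqs[OF assms]
  show "dist B C + dist C A + dist A B \<noteq> 0" using sides by linarith
  show "dist B C + dist C A - dist A B + (dist A B + dist B C - dist C A) \<noteq> 0" using sides by linarith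
qed (simp add: power2_eq_square algebra_simps)

text \<open>The excircle touches \<open>BC\<close> at the mirror image of the incircle's contact in
  the midpoint, so the two weights are exchanged.\<close>

lemma closest_point_excenter:
  assumes "signed_area A B C \<noteq> 0"
  shows "closest_point (line B C) (excenter (A, B, C)) =
    bary_point (A, B, C) 0 (dist A B + dist B C - dist C A) (dist B C + dist C A - dist A B)"
  unfolding excenter_eq[OF assms]
proof (rule closest_point_bary_point)
  note sides = triangle_ineqs[OF assms]
  show "- dist B C + dist C A + dist A B \<noteq> 0" using sides by linarith
  show "dist A B + dist B C - dist C A + (dist B C + dist C A - dist A B) \<noteq> 0" using sides by linarith
qed (simp add: power2_eq_square algebra_simps)

lemma signed_area_rotations:
  assumes "signed_area A B C \<noteq> 0"
  shows "signed_area B C A \<noteq> 0" "signed_area C A B \<noteq> 0"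
  using assms signed_area_rotate[of B C A] signed_area_rotate[of C A B] by simp_all

lemma bary_point_rotations:
  "bary_point (B, C, A) v w u = bary_point (A, B, C) u v w"
  "bary_point (C, A, B) w u v = bary_point (A, B, C) u v w"
  by (simp_all only: bary_point_rotate[of B C A] bary_point_rotate[of C A B])

section \<open>Gergonne, Nagel and Lemoine points\<close>

text \<open>Scales a foot by \<open>k\<close> and adds a weight at \<open>A\<close>, so that the
  cevian is written through the intended common point.\<close>

lemma line_foot:
  assumes "k \<noteq> 0" "v' + w' \<noteq> 0" "u + k * v' + k * w' \<noteq> 0"
  shows "line A (bary_point (A, B, C) 0 v' w') = line A (bary_point (A, B, C) u (k * v') (k * w'))"
proof -
  have "bary_point (A, B, C) 0 v' w' = bary_point (A, B, C) 0 (k * v') (k * w')"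
    using bary_point_scale[OF assms(1), of "(A, B, C)" 0 v' w'] by simp
  moreover have "0 + k * v' + k * w' \<noteq> 0" using assms(1,2) by (simp flip: distrib_left)
  ultimately show ?thesis using line_bary_point[OF _ assms(3), of 0] by simp
qed

text \<open>The weights are \<open>1/x : 1/y : 1/z\<close> with denominators cleared.\<close>

lemma gergonne_point_eq:
  fixes A B C :: point
  defines "x \<equiv> dist C A + dist A B - dist B C" and "y \<equiv> dist A B + dist B C - dist C A"
    and "z \<equiv> dist B C + dist C A - dist A B"
  assumes "signed_area A B C \<noteq> 0"
  shows "gergonne_point (A, B, C) = bary_point (A, B, C) (y * z) (z * x) (x * y)"
proof -
  let ?G = "bary_point (A, B, C) (y * z) (z * x) (x * y)"
  have pos: "x > 0" "y > 0" "z > 0"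
    using triangle_ineqs[OF assms(4)] unfolding x_def y_def z_def by linarith+
  then have prods: "y * z > 0" "z * x > 0" "x * y > 0" by simp_all
  then have nonzero: "y * z + x * z + x * y \<noteq> 0" "z * x + y * x + y * z \<noteq> 0" "x * y + z * y + z * x \<noteq> 0"
    using mult.commute[of x y] mult.commute[of y z] mult.commute[of z x] by linarith+
  \<comment> \<open>The definition uses one incenter for all three sides, whereas the rotated
    contact lemmas mention rotated triangles.\<close>
  have I: "incenter (A, B, C) = incenter (B, C, A)" "incenter (A, B, C) = incenter (C, A, B)"
    using incenter_eq[OF assms(4)] incenter_eq[OF signed_area_rotations(1)[OF assms(4)]]
      incenter_eq[OF signed_area_rotations(2)[OF assms(4)]]
      bary_point_rotations[of B C A "dist C A" "dist A B" "dist B C"] by simp_all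
  have touch: "closest_point (line B C) (incenter (A, B, C)) = bary_point (A, B, C) 0 z y"
    "closest_point (line C A) (incenter (B, C, A)) = bary_point (B, C, A) 0 x z"
    "closest_point (line A B) (incenter (C, A, B)) = bary_point (C, A, B) 0 y x"
    using closest_point_incenter[OF assms(4)]
      closest_point_incenter[OF signed_area_rotations(1)[OF assms(4)]]
      closest_point_incenter[OF signed_area_rotations(2)[OF assms(4)]]
    unfolding x_def y_def z_def by simp_all
  have "line A (bary_point (A, B, C) 0 z y) = line A (bary_point (A, B, C) (y * z) (x * z) (x * y))"
    by (rule line_foot) (use pos nonzero in auto)
  moreover have "line B (bary_point (B, C, A) 0 x z) = line B (bary_point (B, C, A) (z * x) (y * x) (y * z))"
    by (rule line_foot) (use pos nonzero in auto)
  moreover have "line C (bary_point (C, A, B) 0 y x) = line C (bary_point (C, A, B) (x * y) (z * y) (z * x))"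
    by (rule line_foot) (use pos nonzero in auto)
  moreover have "bary_point (A, B, C) (y * z) (x * z) (x * y) = ?G"
    "bary_point (B, C, A) (z * x) (y * x) (y * z) = ?G"
    "bary_point (C, A, B) (x * y) (z * y) (z * x) = ?G"
    using bary_point_rotations(1)[of B C A "z * x" "x * y" "y * z"]
      bary_point_rotations(2)[of C A B "x * y" "y * z" "z * x"] by (simp_all add: mult.commute)
  ultimately have "gergonne_point (A, B, C) = the_elem (line A ?G \<inter> line B ?G \<inter> line C ?G)"
    unfolding gergonne_point.simps Let_def touch[folded I] by simp
  also have "\<dots> = ?G"
    by (rule the_elem_cevians[OF assms(4)]) (use prods in auto)
  finally show ?thesis .
qed

lemma nagel_point_eq:
  fixes A B C :: point
  defines "x \<equiv> dist C A + dist A B - dist B C" and "y \<equiv> dist A B + dist B C - dist C A"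
    and "z \<equiv> dist B C + dist C A - dist A B"
  assumes "signed_area A B C \<noteq> 0"
  shows "nagel_point (A, B, C) = bary_point (A, B, C) x y z"
proof -
  let ?N = "bary_point (A, B, C) x y z"
  have pos: "x > 0" "y > 0" "z > 0"
    using triangle_ineqs[OF assms(4)] unfolding x_def y_def z_def by linarith+
  have touch: "closest_point (line B C) (excenter (A, B, C)) = bary_point (A, B, C) 0 y z"
    "closest_point (line C A) (excenter (B, C, A)) = bary_point (B, C, A) 0 z x"
    "closest_point (line A B) (excenter (C, A, B)) = bary_point (C, A, B) 0 x y"
    using closest_point_excenter[OF assms(4)]
      closest_point_excenter[OF signed_area_rotations(1)[OF assms(4)]]
      closest_point_excenter[OF signed_area_rotations(2)[OF assms(4)]]
    unfolding x_def y_def z_def by simp_all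
  have "line A (bary_point (A, B, C) 0 y z) = line A ?N"
    by (rule line_bary_point) (use pos in auto)
  moreover have "line B (bary_point (B, C, A) 0 z x) = line B (bary_point (B, C, A) y z x)"
    by (rule line_bary_point) (use pos in auto)
  moreover have "line C (bary_point (C, A, B) 0 x y) = line C (bary_point (C, A, B) z x y)"
    by (rule line_bary_point) (use pos in auto)
  ultimately have "nagel_point (A, B, C) = the_elem (line A ?N \<inter> line B ?N \<inter> line C ?N)"
    unfolding nagel_point.simps touch bary_point_rotations(1)[of B C A y z x]
      bary_point_rotations(2)[of C A B z x y] by simp
  also have "\<dots> = ?N"
    by (rule the_elem_cevians[OF assms(4)]) (use pos in auto)
  finally show ?thesis .
qed

text \<open>For \<open>e\<close> and \<open>f\<close> of equal length, \<open>e + f\<close> and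
  \<open>e - f\<close> are orthogonal. Reflection in the direction \<open>e + f\<close> thus swaps
  the two coefficients, and \<open>?Q\<close> is the midpoint of the point and its image.\<close>

lemma reflection_bisector:
  fixes A e f :: point
  assumes "k \<noteq> 0" "e \<bullet> e = f \<bullet> f"
  shows "reflection (line A (A + k *\<^sub>R (e + f))) (A + s *\<^sub>R e + t *\<^sub>R f) = A + t *\<^sub>R e + s *\<^sub>R f"
proof -
  let ?Q = "A + ((s + t) / 2) *\<^sub>R (e + f)"
  have "?Q = A + ((s + t) / (2 * k)) *\<^sub>R (A + k *\<^sub>R (e + f) - A)"
    using assms(1) by (simp del: scaleR_right_distrib)
  then have "?Q \<in> line A (A + k *\<^sub>R (e + f))" unfolding line_alt by blast
  moreover have "(A + s *\<^sub>R e + t *\<^sub>R f) - ?Q = ((s - t) / 2) *\<^sub>R (e - f)"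
    by (simp add: vec_eq_iff field_simps)
  then have "((A + s *\<^sub>R e + t *\<^sub>R f) - ?Q) \<bullet> (A + k *\<^sub>R (e + f) - A) = 0"
    using assms(2) by (simp add: inner_add_right inner_diff_left inner_diff_right inner_commute)
  ultimately have closest: "closest_point (line A (A + k *\<^sub>R (e + f))) (A + s *\<^sub>R e + t *\<^sub>R f) = ?Q"
    by (rule closest_point_line(1))
  show ?thesis
    unfolding reflection_def closest by (simp add: vec_eq_iff field_simps)
qed

text \<open>In unit vectors \<open>e\<close>, \<open>f\<close> along the sides at \<open>A\<close>,
  the bisector has direction \<open>e + f\<close> and the median \<open>c e + b f\<close>. Its
  reflection \<open>b e + c f\<close> is parallel to
  \<open>b^2 (B - A) + c^2 (C - A)\<close>.\<close>

lemma symmedian_eq: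
  assumes "signed_area A B C \<noteq> 0"
  shows "symmedian (A, B, C) =
    line A (bary_point (A, B, C) ((dist B C)\<^sup>2) ((dist C A)\<^sup>2) ((dist A B)\<^sup>2))"
proof -
  define a b c where "a = dist B C" and "b = dist C A" and "c = dist A B"
  have pos: "a > 0" "b > 0" "c > 0"
    using triangle_ineqs[OF assms] unfolding a_def b_def c_def by simp_all
  define e f where "e = (1 / c) *\<^sub>R (B - A)" and "f = (1 / b) *\<^sub>R (C - A)"
  have B: "B - A = c *\<^sub>R e" and C: "C - A = b *\<^sub>R f"
    unfolding e_def f_def using pos by simp_all
  have unit: "e \<bullet> e = 1" "f \<bullet> f = 1"
    unfolding e_def f_def inner_scaleR_left inner_scaleR_right inner_sides
    using pos unfolding b_def c_def by (simp_all add: power2_eq_square dist_commute)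
  have "a + b + c \<noteq> 0" using pos by linarith
  from bary_point_minus_vertex[OF this, of A B C]
  have "incenter (A, B, C) - A = (b * c / (a + b + c)) *\<^sub>R (e + f)"
    unfolding incenter_eq[OF assms, folded a_def b_def c_def] B C
    by (simp add: scaleR_right_distrib mult.commute)
  then have I: "incenter (A, B, C) = A + (b * c / (a + b + c)) *\<^sub>R (e + f)"
    by (simp add: diff_eq_eq add.commute)
  have median: "midpoint B C - A = (c / 2) *\<^sub>R e + (b / 2) *\<^sub>R f"
  proof -
    have "midpoint B C - A = (1 / 2) *\<^sub>R ((B - A) + (C - A))"
      by (simp add: midpoint_def vec_eq_iff field_simps)
    then show ?thesis unfolding B C by (simp add: scaleR_right_distrib)
  qed
  let ?r = "reflection (line A (incenter (A, B, C)))" and ?X = "A + (b / 2) *\<^sub>R e + (c / 2) *\<^sub>R f"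
  have "?r (A + t *\<^sub>R (midpoint B C - A)) = A + t *\<^sub>R (?X - A)" for t
  proof -
    have "?r (A + (t * (c / 2)) *\<^sub>R e + (t * (b / 2)) *\<^sub>R f) = A + (t * (b / 2)) *\<^sub>R e + (t * (c / 2)) *\<^sub>R f"
      unfolding I by (rule reflection_bisector) (use pos unit in auto)
    then show ?thesis unfolding median by (simp add: scaleR_right_distrib add.assoc)
  qed
  then have "symmedian (A, B, C) = line A ?X"
    unfolding symmedian.simps line_alt[of A] image_image by (simp only: flip: line_alt)
  also have "\<dots> = line A (bary_point (A, B, C) (a\<^sup>2) (b\<^sup>2) (c\<^sup>2))"
  proof (rule line_scale)
    have s: "a\<^sup>2 + b\<^sup>2 + c\<^sup>2 > 0" using pos by (simp add: add_pos_pos)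
    \<comment> \<open>The factor undoes the normalization by the weight sum and the extracted
      \<open>b * c\<close>, and restores the half of the midpoint.\<close>
    then show "(a\<^sup>2 + b\<^sup>2 + c\<^sup>2) / (2 * (b * c)) \<noteq> 0" using pos by simp
    have "bary_point (A, B, C) (a\<^sup>2) (b\<^sup>2) (c\<^sup>2) - A =
        (1 / (a\<^sup>2 + b\<^sup>2 + c\<^sup>2)) *\<^sub>R ((b * c) *\<^sub>R (b *\<^sub>R e + c *\<^sub>R f))"
      using bary_point_minus_vertex[of "a\<^sup>2" "b\<^sup>2" "c\<^sup>2" A B C] s unfolding B C
      by (simp add: scaleR_right_distrib power2_eq_square mult_ac)
    then have "((a\<^sup>2 + b\<^sup>2 + c\<^sup>2) / (2 * (b * c))) *\<^sub>R (bary_point (A, B, C) (a\<^sup>2) (b\<^sup>2) (c\<^sup>2) - A) =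
        ((a\<^sup>2 + b\<^sup>2 + c\<^sup>2) / (2 * (b * c)) * (1 / (a\<^sup>2 + b\<^sup>2 + c\<^sup>2)) * (b * c)) *\<^sub>R (b *\<^sub>R e + c *\<^sub>R f)"
      by (simp only: scaleR_scaleR mult.assoc)
    also have "(a\<^sup>2 + b\<^sup>2 + c\<^sup>2) / (2 * (b * c)) * (1 / (a\<^sup>2 + b\<^sup>2 + c\<^sup>2)) * (b * c) = 1 / 2"
      using s pos by (simp add: field_simps)
    finally show "?X - A = ((a\<^sup>2 + b\<^sup>2 + c\<^sup>2) / (2 * (b * c))) *\<^sub>R
        (bary_point (A, B, C) (a\<^sup>2) (b\<^sup>2) (c\<^sup>2) - A)"
      by (simp add: scaleR_right_distrib)
  qed
  finally show ?thesis unfolding a_def b_def c_def .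
qed

lemma lemoine_point_eq:
  assumes "signed_area A B C \<noteq> 0"
  shows "lemoine_point (A, B, C) = bary_point (A, B, C) ((dist B C)\<^sup>2) ((dist C A)\<^sup>2) ((dist A B)\<^sup>2)"
    (is "_ = ?L")
proof -
  have "symmedian (A, B, C) = line A ?L" "symmedian (B, C, A) = line B ?L" "symmedian (C, A, B) = line C ?L"
    using symmedian_eq[OF assms] symmedian_eq[OF signed_area_rotations(1)[OF assms]]
      symmedian_eq[OF signed_area_rotations(2)[OF assms]]
      bary_point_rotations[of B C A "(dist C A)\<^sup>2" "(dist A B)\<^sup>2" "(dist B C)\<^sup>2"] by simp_all
  moreover have "(dist B C)\<^sup>2 + (dist C A)\<^sup>2 + (dist A B)\<^sup>2 > 0" "(dist A B)\<^sup>2 > 0"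
    using triangle_ineqs(1-3)[OF assms] by (simp_all add: add_pos_pos)
  ultimately show ?thesis
    unfolding lemoine_point.simps using the_elem_cevians[OF assms, of _ _ _ ?L] by simp
qed

section \<open>Orthocenter and the medial triangle\<close>

text \<open>Cramer's rule: two sides of a nondegenerate triangle span the plane. This gives
  uniqueness of the orthocenter.\<close>

lemma inner_independent:
  fixes A B C X :: point
  assumes "signed_area A B C \<noteq> 0" "X \<bullet> (B - C) = 0" "X \<bullet> (C - A) = 0"
  shows "X = 0"
proof -
  have eqs: "X$1 * (B$1 - C$1) + X$2 * (B$2 - C$2) = 0" "X$1 * (C$1 - A$1) + X$2 * (C$2 - A$2) = 0"
    using assms(2,3) by (simp_all add: inner_vec_def sum_2)
  have "X$1 * (2 * signed_area A B C) = 0" "X$2 * (2 * signed_area A B C) = 0"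
    unfolding double_signed_area using eqs by algebra+
  then show ?thesis using assms(1) by (simp add: vec_eq_iff forall_2)
qed

text \<open>The weights are the classical \<open>1/p : 1/q : 1/r\<close>, cleared of denominators so
  that right triangles are included. Their sum is 16 times the squared area by Heron.\<close>

lemma orthocenter_eq:
  fixes A B C :: point
  defines "p \<equiv> (dist C A)\<^sup>2 + (dist A B)\<^sup>2 - (dist B C)\<^sup>2" and "q \<equiv> (dist A B)\<^sup>2 + (dist B C)\<^sup>2 - (dist C A)\<^sup>2"
    and "r \<equiv> (dist B C)\<^sup>2 + (dist C A)\<^sup>2 - (dist A B)\<^sup>2"
  assumes "signed_area A B C \<noteq> 0"
  shows "q * r + r * p + p * q > 0" (is "?s > 0")
    and "orthocenter (A, B, C) = bary_point (A, B, C) (q * r) (r * p) (p * q)"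
proof -
  let ?H = "bary_point (A, B, C) (q * r) (r * p) (p * q)"
  have "?s = 16 * (signed_area A B C)\<^sup>2"
    unfolding heron[symmetric] p_def q_def r_def by (simp add: power2_eq_square algebra_simps)
  then show s: "?s > 0" using assms(4) by simp
  have altitude: "(?H - A) \<bullet> (B - C) = 0"
  proof -
    have "(?H - A) \<bullet> (C - B) = 0"
      using s unfolding p_def q_def r_def by (subst inner_bary_point) auto
    then show ?thesis by (simp add: inner_diff_right)
  qed
  have altitude_B: "(?H - B) \<bullet> (C - A) = 0"
  proof -
    have "bary_point (B, C, A) (r * p) (p * q) (q * r) = ?H"
      by (rule bary_point_rotations)
    moreover have "(bary_point (B, C, A) (r * p) (p * q) (q * r) - B) \<bullet> (A - C) = 0"
      using s unfolding p_def q_def r_def by (subst inner_bary_point) auto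
    ultimately show ?thesis by (simp add: inner_diff_right)
  qed
  show "orthocenter (A, B, C) = ?H"
    unfolding orthocenter.simps
  proof (rule the_equality)
    \<comment> \<open>The three altitude expressions sum to zero for every point, so the third
      condition follows from the other two.\<close>
    have "(?H - C) \<bullet> (A - B) = - ((?H - A) \<bullet> (B - C)) - (?H - B) \<bullet> (C - A)"
      by (simp add: inner_diff_left inner_diff_right inner_commute)
    then show "(?H - A) \<bullet> (B - C) = 0 \<and> (?H - B) \<bullet> (C - A) = 0 \<and> (?H - C) \<bullet> (A - B) = 0"
      using altitude altitude_B by simp
    fix P assume P: "(P - A) \<bullet> (B - C) = 0 \<and> (P - B) \<bullet> (C - A) = 0 \<and> (P - C) \<bullet> (A - B) = 0"
    have "(P - ?H) \<bullet> (B - C) = 0" and "(P - ?H) \<bullet> (C - A) = 0"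
      using P altitude altitude_B by (simp_all add: inner_diff_left)
    then have "P - ?H = 0" by (rule inner_independent[OF assms(4)])
    then show "P = ?H" by simp
  qed
qed

section \<open>Circumcenter and change to the medial triangle\<close>

lemma dist_eq_iff_bisector:
  fixes P B C :: point
  shows "dist P B = dist P C \<longleftrightarrow> (P - midpoint B C) \<bullet> (B - C) = 0"
proof -
  have "dist P B = dist P C \<longleftrightarrow> (P - B) \<bullet> (P - B) = (P - C) \<bullet> (P - C)"
    by (simp add: dist_norm norm_eq)
  also have "\<dots> \<longleftrightarrow> ((1 / 2) *\<^sub>R ((P - B) + (P - C))) \<bullet> ((P - C) - (P - B)) = 0"
    unfolding inner_scaleR_left inner_add_left inner_diff_right[of _ "P - C"] inner_commute[of "P - C" "P - B"]
    by auto
  also have "(1 / 2) *\<^sub>R ((P - B) + (P - C)) = P - midpoint B C"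
    by (simp add: midpoint_def vec_eq_iff field_simps)
  also have "(P - C) - (P - B) = B - C" by simp
  finally show ?thesis .
qed

text \<open>The sides of the medial triangle are parallel to those of \<open>ABC\<close>, so its
  altitudes are the perpendicular bisectors of \<open>ABC\<close>. The two descriptions have
  equivalent predicates.\<close>

lemma circumcenter_eq_orthocenter_medial:
  "circumcenter (A, B, C) = orthocenter (medial_triangle (A, B, C))"
proof -
  have "midpoint C A - midpoint A B = - (1 / 2) *\<^sub>R (B - C)"
    "midpoint A B - midpoint B C = - (1 / 2) *\<^sub>R (C - A)"
    "midpoint B C - midpoint C A = - (1 / 2) *\<^sub>R (A - B)"
    by (simp_all add: midpoint_def vec_eq_iff field_simps)
  moreover have "dist P A = dist P B \<and> dist P B = dist P C \<longleftrightarrow>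
      dist P B = dist P C \<and> dist P C = dist P A \<and> dist P A = dist P B" for P
    by auto
  ultimately show ?thesis
    unfolding medial_triangle.simps circumcenter.simps orthocenter.simps
    by (simp add: dist_eq_iff_bisector)
qed

text \<open>The midpoints form a parallelogram with each vertex, which recovers the vertices from
  them.\<close>

lemma anticomplementary_medial: "anticomplementary_triangle (medial_triangle T) = T"
  unfolding anticomplementary_triangle_def
proof (rule the_equality)
  fix T' assume eq: "medial_triangle T' = medial_triangle T"
  obtain A B C A' B' C' where T: "T = (A, B, C)" "T' = (A', B', C')" by (metis prod.collapse)
  have vertex: "A = midpoint C A + midpoint A B - midpoint B C" for A B C :: point
    by (simp add: midpoint_def vec_eq_iff field_simps)
  have "midpoint B' C' = midpoint B C" "midpoint C' A' = midpoint C A" "midpoint A' B' = midpoint A B"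
    using eq unfolding T by simp_all
  then have "A' = A" "B' = B" "C' = C"
    using vertex[of A' C' B'] vertex[of A C B] vertex[of B' A' C'] vertex[of B A C]
      vertex[of C' B' A'] vertex[of C B A] by simp_all
  then show "T' = T" unfolding T by simp
qed simp

lemma bary_point_medial:
  "bary_point (medial_triangle (A, B, C)) x y z = bary_point (A, B, C) (y + z) (z + x) (x + y)"
proof -
  have "x *\<^sub>R midpoint B C + y *\<^sub>R midpoint C A + z *\<^sub>R midpoint A B =
      (1 / 2) *\<^sub>R ((y + z) *\<^sub>R A + (z + x) *\<^sub>R B + (x + y) *\<^sub>R C)"
    by (simp add: midpoint_def vec_eq_iff field_simps)
  moreover have "(y + z) + (z + x) + (x + y) = 2 * (x + y + z)" by simp
  ultimately show ?thesis by (simp only: medial_triangle.simps bary_point.simps) simp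
qed

text \<open>Inverse of the preceding change of weights, up to the factor 2.\<close>

lemma bary_point_eq_medial:
  "bary_point (A, B, C) u v w = bary_point (medial_triangle (A, B, C)) (v + w - u) (w + u - v) (u + v - w)"
  using bary_point_scale[of 2 "(A, B, C)" u v w] unfolding bary_point_medial by simp

lemma signed_area_medial:
  "signed_area (midpoint B C) (midpoint C A) (midpoint A B) = signed_area A B C / 4"
  by (simp add: midpoint_def signed_area_def field_simps)

lemma dist_medial:
  fixes A B C :: point
  shows "dist (midpoint C A) (midpoint A B) = dist B C / 2"
proof -
  have "midpoint C A - midpoint A B = (1 / 2) *\<^sub>R (C - B)"
    by (simp add: midpoint_def vec_eq_iff field_simps)
  then show ?thesis by (simp only: dist_norm norm_scaleR) (simp add: norm_minus_commute)
qed

section \<open>The excentral triangle\<close>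

lemma dist_excenters:
  assumes "signed_area A B C \<noteq> 0"
  shows "(dist (excenter (B, C, A)) (excenter (C, A, B)))\<^sup>2 =
    4 * dist B C ^ 2 * dist C A * dist A B /
      ((dist A B + dist B C - dist C A) * (dist B C + dist C A - dist A B))"
proof -
  define a b c where "a = dist B C" and "b = dist C A" and "c = dist A B"
  note ineqs = triangle_ineqs[OF assms, folded a_def b_def c_def]
  have s: "c + a - b > 0" "a + b - c > 0" using ineqs by linarith+
  have JB: "excenter (B, C, A) = bary_point (A, B, C) a (- b) c"
    and JC: "excenter (C, A, B) = bary_point (A, B, C) a b (- c)"
    using excenter_eq[OF signed_area_rotations(1)[OF assms]] excenter_eq[OF signed_area_rotations(2)[OF assms]]
    unfolding a_def b_def c_def by (simp_all only: bary_point_rotations(1)[of B C A] bary_point_rotations(2)[of C A B])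
  have sums: "a + - b + c \<noteq> 0" "a + b + - c \<noteq> 0" using s by linarith+
  \<comment> \<open>Direction of the external bisector at \<open>A\<close>, which carries both
    excenters.\<close>
  define X where "X = c *\<^sub>R (C - A) - b *\<^sub>R (B - A)"
  have "excenter (B, C, A) - A = (1 / (c + a - b)) *\<^sub>R X"
    unfolding JB bary_point_minus_vertex[OF sums(1)] X_def by (simp add: algebra_simps)
  moreover have "excenter (C, A, B) - A = - (1 / (a + b - c)) *\<^sub>R X"
    unfolding JC bary_point_minus_vertex[OF sums(2)] X_def by (simp add: algebra_simps)
  ultimately have "excenter (B, C, A) - excenter (C, A, B) = (1 / (c + a - b) + 1 / (a + b - c)) *\<^sub>R X"
    by (simp add: scaleR_left_distrib diff_eq_eq add.assoc)
  also have "1 / (c + a - b) + 1 / (a + b - c) = 2 * a / ((c + a - b) * (a + b - c))"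
    using s by (simp add: field_simps)
  finally have "(dist (excenter (B, C, A)) (excenter (C, A, B)))\<^sup>2 =
      (2 * a / ((c + a - b) * (a + b - c)))\<^sup>2 * (X \<bullet> X)"
    by (simp only: dist_norm norm_scaleR power_mult_distrib power2_abs power2_norm_eq_inner)
  also have "X \<bullet> X = c\<^sup>2 * ((C - A) \<bullet> (C - A)) + b\<^sup>2 * ((B - A) \<bullet> (B - A)) - 2 * b * c * ((B - A) \<bullet> (C - A))"
    unfolding X_def by (simp only: inner_diff_left[of "c *\<^sub>R _"] inner_diff_right[of _ "c *\<^sub>R _"]
        inner_scaleR_left inner_scaleR_right inner_commute[of "C - A" "B - A"]) (simp add: power2_eq_square algebra_simps)
  also have "\<dots> = b * c * ((c + a - b) * (a + b - c))"
    unfolding inner_sides dist_commute[of A C] a_def b_def c_def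
    by (simp add: power2_eq_square field_simps)
  also have "(2 * a / ((c + a - b) * (a + b - c)))\<^sup>2 * (b * c * ((c + a - b) * (a + b - c))) =
      4 * a\<^sup>2 * b * c / ((c + a - b) * (a + b - c))"
    using s by (simp add: power2_eq_square)
  finally show ?thesis unfolding a_def b_def c_def .
qed

text \<open>The squared excentral sides are \<open>k\<close> times \<open>a x\<close>,
  \<open>b y\<close>, \<open>c z\<close>, which gives the Lemoine weights there. These weights turn
  out to be the same relative to \<open>ABC\<close>.\<close>

lemma mittenpunkt_eq:
  fixes A B C :: point
  defines "x \<equiv> dist C A + dist A B - dist B C" and "y \<equiv> dist A B + dist B C - dist C A"
    and "z \<equiv> dist B C + dist C A - dist A B"
  assumes "signed_area A B C \<noteq> 0"
  shows "mittenpunkt (A, B, C) = bary_point (A, B, C) (dist B C * x) (dist C A * y) (dist A B * z)"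
proof -
  define a b c where "a = dist B C" and "b = dist C A" and "c = dist A B"
  define JA JB JC where "JA = excenter (A, B, C)" and "JB = excenter (B, C, A)" and "JC = excenter (C, A, B)"
  have xyz: "x = b + c - a" "y = c + a - b" "z = a + b - c"
    unfolding x_def y_def z_def a_def b_def c_def by simp_all
  have pos: "a > 0" "b > 0" "c > 0" "x > 0" "y > 0" "z > 0"
    using triangle_ineqs[OF assms(4)] unfolding xyz a_def b_def c_def by simp_all
  define k where "k = 4 * a * b * c / (x * y * z)"
  have k: "k \<noteq> 0" using pos unfolding k_def by simp
  have "(dist JB JC)\<^sup>2 = 4 * a\<^sup>2 * b * c / (y * z)" "(dist JC JA)\<^sup>2 = 4 * b\<^sup>2 * c * a / (z * x)"
    "(dist JA JB)\<^sup>2 = 4 * c\<^sup>2 * a * b / (x * y)"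
    using dist_excenters[OF assms(4)] dist_excenters[OF signed_area_rotations(1)[OF assms(4)]]
      dist_excenters[OF signed_area_rotations(2)[OF assms(4)]]
    unfolding xyz a_def b_def c_def JA_def JB_def JC_def by simp_all
  then have sq: "(dist JB JC)\<^sup>2 = k * (a * x)" "(dist JC JA)\<^sup>2 = k * (b * y)" "(dist JA JB)\<^sup>2 = k * (c * z)"
    using pos unfolding k_def by (simp_all add: power2_eq_square mult_ac)
  \<comment> \<open>Heron in squared sides, to which \<open>sq\<close> applies, shows that the
    excentral triangle is nondegenerate.\<close>
  have "16 * (signed_area JA JB JC)\<^sup>2 = 2 * ((dist JB JC)\<^sup>2 * (dist JC JA)\<^sup>2
      + (dist JC JA)\<^sup>2 * (dist JA JB)\<^sup>2 + (dist JA JB)\<^sup>2 * (dist JB JC)\<^sup>2)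
      - ((dist JB JC)\<^sup>2)\<^sup>2 - ((dist JC JA)\<^sup>2)\<^sup>2 - ((dist JA JB)\<^sup>2)\<^sup>2"
    unfolding heron[symmetric] by (simp add: power2_eq_square algebra_simps)
  also have "\<dots> = k\<^sup>2 * ((a + b + c) * x * y * z)"
    unfolding sq xyz by (simp add: power2_eq_square algebra_simps)
  finally have "signed_area JA JB JC \<noteq> 0"
    using k pos by (auto simp: add_pos_pos)
  then have "mittenpunkt (A, B, C) = bary_point (JA, JB, JC) (k * (a * x)) (k * (b * y)) (k * (c * z))"
    unfolding mittenpunkt_def excentral_triangle.simps sq[symmetric] JA_def JB_def JC_def
    by (rule lemoine_point_eq)
  also have "\<dots> = bary_point (JA, JB, JC) (a * x) (b * y) (c * z)"
    by (rule bary_point_scale[OF k])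
  also have "\<dots> = bary_point (A, B, C) (a * x) (b * y) (c * z)"
  proof -
    have "JA = bary_point (A, B, C) (- a) b c" "JB = bary_point (A, B, C) a (- b) c"
      "JC = bary_point (A, B, C) a b (- c)"
      using excenter_eq[OF assms(4)] excenter_eq[OF signed_area_rotations(1)[OF assms(4)]]
        excenter_eq[OF signed_area_rotations(2)[OF assms(4)]]
      unfolding a_def b_def c_def JA_def JB_def JC_def
      by (simp_all only: bary_point_rotations(1)[of B C A] bary_point_rotations(2)[of C A B])
    moreover have "- a + b + c = x" "a + - b + c = y" "a + b + - c = z" unfolding xyz by simp_all
    ultimately have J: "x *\<^sub>R JA = - a *\<^sub>R A + b *\<^sub>R B + c *\<^sub>R C"
      "y *\<^sub>R JB = a *\<^sub>R A + - b *\<^sub>R B + c *\<^sub>R C" "z *\<^sub>R JC = a *\<^sub>R A + b *\<^sub>R B + - c *\<^sub>R C"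
      using pos by (simp_all add: bary_point.simps)
    \<comment> \<open>The factors \<open>x\<close>, \<open>y\<close>, \<open>z\<close> are the
      weight sums of the excenters and cancel their normalizations.\<close>
    have "(a * x) *\<^sub>R JA + (b * y) *\<^sub>R JB + (c * z) *\<^sub>R JC =
        a *\<^sub>R (x *\<^sub>R JA) + b *\<^sub>R (y *\<^sub>R JB) + c *\<^sub>R (z *\<^sub>R JC)"
      by simp
    also have "\<dots> = (a * x) *\<^sub>R A + (b * y) *\<^sub>R B + (c * z) *\<^sub>R C"
      unfolding J unfolding xyz by (simp add: vec_eq_iff algebra_simps)
    finally show ?thesis unfolding bary_point.simps by simp
  qed
  finally show ?thesis unfolding a_def b_def c_def .
qed

section \<open>The Lucas cubic\<close>

text \<open>The collinearity determinant of \<open>x : y : z\<close>, its isotomic conjugate and the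
  pivot \<open>l : m : n\<close>.\<close>

definition lucas_form :: "real \<Rightarrow> real \<Rightarrow> real \<Rightarrow> real \<Rightarrow> real \<Rightarrow> real \<Rightarrow> real" where
  "lucas_form l m n x y z = l * x * (y\<^sup>2 - z\<^sup>2) + m * y * (z\<^sup>2 - x\<^sup>2) + n * z * (x\<^sup>2 - y\<^sup>2)"

lemma projectively_collinear_isotomic:
  "projectively_collinear v (isotomic v) w \<longleftrightarrow>
    lucas_form (w$1) (w$2) (w$3) (v$1) (v$2) (v$3) = 0"
proof -
  have "det (vector [v, isotomic v, w] :: real^3^3) = lucas_form (w$1) (w$2) (w$3) (v$1) (v$2) (v$3)"
    by (simp add: det_3 isotomic_def lucas_form_def power2_eq_square algebra_simps)
  then show ?thesis by (simp add: projectively_collinear_def)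
qed

lemma lucas_form_scale:
  "lucas_form (h * l) (h * m) (h * n) (k * x) (k * y) (k * z) = h * k ^ 3 * lucas_form l m n x y z"
  by (simp add: lucas_form_def power2_eq_square power3_eq_cube algebra_simps)

text \<open>Area coordinates are the weights up to a nonzero factor, and the form is homogeneous of
  degree 1 in the pivot and 3 in the point.\<close>

lemma projectively_collinear_bary_point:
  assumes "signed_area A B C \<noteq> 0" "x + y + z \<noteq> 0" "l + m + n \<noteq> 0"
  shows "projectively_collinear (barycentric (A, B, C) (bary_point (A, B, C) x y z))
      (isotomic (barycentric (A, B, C) (bary_point (A, B, C) x y z)))
      (barycentric (A, B, C) (bary_point (A, B, C) l m n)) \<longleftrightarrow> lucas_form l m n x y z = 0"
  unfolding projectively_collinear_isotomic barycentric_bary_point[OF assms(2)]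
    barycentric_bary_point[OF assms(3)]
  using assms by (simp only: vector_scaleR_component vector_3 real_scaleR_def lucas_form_scale) simp

text \<open>The function \<open>g\<close> is the homogeneous part of degree 3 of \<open>f\<close>; the locus \<open>f = 0\<close> is a genuine
  cubic as soon as \<open>g\<close> does not vanish identically.\<close>

definition cubic_with_top :: "(real \<Rightarrow> real \<Rightarrow> real) \<Rightarrow> (real \<Rightarrow> real \<Rightarrow> real) \<Rightarrow> bool" where
  "cubic_with_top f g \<longleftrightarrow> (\<exists>c :: nat \<Rightarrow> nat \<Rightarrow> real.
     (\<forall>x y. f x y = (\<Sum>i\<le>3. \<Sum>j\<le>3 - i. c i j * x ^ i * y ^ j)) \<and>
     (\<forall>x y. g x y = (\<Sum>i\<le>3. c i (3 - i) * x ^ i * y ^ (3 - i))))"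

lemma cubic_with_top_product:
  "cubic_with_top
     (\<lambda>x y. (p0 + p1 * x + p2 * y) * (q0 + q1 * x + q2 * y) * (r0 + r1 * x + r2 * y))
     (\<lambda>x y. (p1 * x + p2 * y) * (q1 * x + q2 * y) * (r1 * x + r2 * y))"
  unfolding cubic_with_top_def
proof (intro exI conjI allI)
  \<comment> \<open>Row \<open>i\<close> lists the coefficients of \<open>x^i y^j\<close> for
    \<open>j\<close> from 0 to \<open>3 - i\<close>, exactly the range read by the sums.\<close>
  let ?c = "\<lambda>i j. [[p0*q0*r0, p0*q0*r2 + p0*q2*r0 + p2*q0*r0, p0*q2*r2 + p2*q0*r2 + p2*q2*r0, p2*q2*r2],
    [p0*q0*r1 + p0*q1*r0 + p1*q0*r0,
     p0*q1*r2 + p0*q2*r1 + p1*q0*r2 + p2*q0*r1 + p1*q2*r0 + p2*q1*r0,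
     p1*q2*r2 + p2*q1*r2 + p2*q2*r1],
    [p0*q1*r1 + p1*q0*r1 + p1*q1*r0, p1*q1*r2 + p1*q2*r1 + p2*q1*r1],
    [p1*q1*r1]] ! i ! j"
  fix x y
  show "(p0 + p1 * x + p2 * y) * (q0 + q1 * x + q2 * y) * (r0 + r1 * x + r2 * y) =
      (\<Sum>i\<le>3. \<Sum>j\<le>3 - i. ?c i j * x ^ i * y ^ j)"
    by (simp add: eval_nat_numeral algebra_simps)
  show "(p1 * x + p2 * y) * (q1 * x + q2 * y) * (r1 * x + r2 * y) =
      (\<Sum>i\<le>3. ?c i (3 - i) * x ^ i * y ^ (3 - i))"
    by (simp add: eval_nat_numeral algebra_simps)
qed

lemma cubic_with_top_add:
  assumes "cubic_with_top f g" "cubic_with_top f' g'"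
  shows "cubic_with_top (\<lambda>x y. f x y + f' x y) (\<lambda>x y. g x y + g' x y)"
proof -
  obtain c where "\<forall>x y. f x y = (\<Sum>i\<le>3. \<Sum>j\<le>3 - i. c i j * x ^ i * y ^ j)"
    "\<forall>x y. g x y = (\<Sum>i\<le>3. c i (3 - i) * x ^ i * y ^ (3 - i))"
    using assms(1) unfolding cubic_with_top_def by blast
  moreover obtain c' where "\<forall>x y. f' x y = (\<Sum>i\<le>3. \<Sum>j\<le>3 - i. c' i j * x ^ i * y ^ j)"
    "\<forall>x y. g' x y = (\<Sum>i\<le>3. c' i (3 - i) * x ^ i * y ^ (3 - i))"
    using assms(2) unfolding cubic_with_top_def by blast
  ultimately show ?thesis
    unfolding cubic_with_top_def
    by (intro exI[of _ "\<lambda>i j. c i j + c' i j"]) (simp add: distrib_right sum.distrib)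
qed

lemma cubic_with_top_scale:
  assumes "cubic_with_top f g"
  shows "cubic_with_top (\<lambda>x y. k * f x y) (\<lambda>x y. k * g x y)"
proof -
  obtain c where "\<forall>x y. f x y = (\<Sum>i\<le>3. \<Sum>j\<le>3 - i. c i j * x ^ i * y ^ j)"
    "\<forall>x y. g x y = (\<Sum>i\<le>3. c i (3 - i) * x ^ i * y ^ (3 - i))"
    using assms unfolding cubic_with_top_def by blast
  then show ?thesis
    unfolding cubic_with_top_def
    by (intro exI[of _ "\<lambda>i j. k * c i j"]) (simp add: sum_distrib_left mult.assoc)
qed

lemma cubic_with_top_lucas_form:
  "cubic_with_top
     (\<lambda>x y. lucas_form l m n (p0 + p1 * x + p2 * y) (q0 + q1 * x + q2 * y) (r0 + r1 * x + r2 * y))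
     (\<lambda>x y. lucas_form l m n (p1 * x + p2 * y) (q1 * x + q2 * y) (r1 * x + r2 * y))"
proof -
  \<comment> \<open>Six scaled products of three linear factors, written with \<open>+ -\<close> so
    that the closure rules for sums and multiples apply.\<close>
  have eq: "lucas_form l m n u v w = l * (u * v * v) + - l * (u * w * w) + m * (v * w * w) + - m * (v * u * u)
      + n * (w * u * u) + - n * (w * v * v)" for u v w
    by (simp add: lucas_form_def power2_eq_square algebra_simps)
  show ?thesis
    unfolding eq by ((rule cubic_with_top_add)+; rule cubic_with_top_scale; rule cubic_with_top_product)
qed

text \<open>If all top coefficients vanished, \<open>g\<close> would be identically zero; one
  nonzero value settles the degree condition.\<close>

lemma cubic_curve_of_top:
  assumes "cubic_with_top f g" "g x y \<noteq> 0"
  shows "cubic_curve {P. f (P$1) (P$2) = 0}"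
proof -
  obtain c where c: "\<forall>x y. f x y = (\<Sum>i\<le>3. \<Sum>j\<le>3 - i. c i j * x ^ i * y ^ j)"
    "\<forall>x y. g x y = (\<Sum>i\<le>3. c i (3 - i) * x ^ i * y ^ (3 - i))"
    using assms(1) unfolding cubic_with_top_def by blast
  have "\<exists>i\<le>3. c i (3 - i) \<noteq> 0"
  proof (rule ccontr)
    assume "\<not> ?thesis"
    then have "g x y = 0" using c(2) by simp
    then show False using assms(2) by simp
  qed
  then show ?thesis unfolding cubic_curve_def using c(1) by auto
qed

lemma cubic_curve_lucas:
  assumes "signed_area A B C \<noteq> 0" "w$2 + w$3 \<noteq> 0"
  shows "cubic_curve {P. projectively_collinear (barycentric (A, B, C) P)
      (isotomic (barycentric (A, B, C) P)) w}"
proof -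
  define p0 where "p0 = (\<lambda>(P :: point) (Q :: point). (P$1 * Q$2 - P$2 * Q$1) / 2)"
  define p1 where "p1 = (\<lambda>(P :: point) (Q :: point). (P$2 - Q$2) / 2)"
  define p2 where "p2 = (\<lambda>(P :: point) (Q :: point). (Q$1 - P$1) / 2)"
  have area: "signed_area X P Q = p0 P Q + p1 P Q * X$1 + p2 P Q * X$2" for X P Q
    unfolding signed_area_def p0_def p1_def p2_def by (simp add: field_simps)
  \<comment> \<open>The linear part of an affine function, evaluated at \<open>Y - X\<close>, is the
    difference of its values.\<close>
  have top: "p1 P Q * (Y$1 - X$1) + p2 P Q * (Y$2 - X$2) = signed_area Y P Q - signed_area X P Q"
    for X Y P Q
    unfolding area by (simp add: algebra_simps)
  txt \<open>The top-degree part is evaluated at the direction of \<open>BC\<close>, along which the first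
    barycentric coordinate is constant.\<close>
  have vals: "signed_area B B C = 0" "signed_area C B C = 0" "signed_area B C A = signed_area A B C"
    "signed_area C C A = 0" "signed_area B A B = 0" "signed_area C A B = signed_area A B C"
    unfolding signed_area_def by (simp_all add: algebra_simps)
  have "lucas_form (w$1) (w$2) (w$3) 0 (- signed_area A B C) (signed_area A B C) =
      - (w$2 + w$3) * signed_area A B C ^ 3"
    unfolding lucas_form_def by (simp add: power2_eq_square power3_eq_cube algebra_simps)
  also have "\<dots> \<noteq> 0" using assms by simp
  finally have nonzero: "lucas_form (w$1) (w$2) (w$3)
      (p1 B C * (C$1 - B$1) + p2 B C * (C$2 - B$2)) (p1 C A * (C$1 - B$1) + p2 C A * (C$2 - B$2))
      (p1 A B * (C$1 - B$1) + p2 A B * (C$2 - B$2)) \<noteq> 0"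
    unfolding top vals by simp
  have "cubic_curve {P. lucas_form (w$1) (w$2) (w$3) (p0 B C + p1 B C * P$1 + p2 B C * P$2)
      (p0 C A + p1 C A * P$1 + p2 C A * P$2) (p0 A B + p1 A B * P$1 + p2 A B * P$2) = 0}"
    by (rule cubic_curve_of_top[OF cubic_with_top_lucas_form nonzero])
  then show ?thesis
    unfolding projectively_collinear_isotomic by (simp add: area)
qed

section \<open>Uniqueness of the cubic and polynomial identities for its points\<close>

lemma bary_point_vertex:
  "bary_point (A, B, C) 1 0 0 = A" "bary_point (A, B, C) 0 1 0 = B" "bary_point (A, B, C) 0 0 1 = C"
  by (simp_all add: bary_point.simps)

lemma centroid_eq: "centroid (A, B, C) = bary_point (A, B, C) 1 1 1"
  by (simp add: bary_point.simps)

text \<open>The locus clause fixes the set off the vertices, and the incidence clause puts the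
  vertices in it.\<close>

lemma is_lucas_cubic_unique:
  assumes "is_lucas_cubic T K" "is_lucas_cubic T K'"
  shows "K = K'"
  using assms unfolding is_lucas_cubic_def by blast

lemma lucas_cubic_eq:
  assumes "is_lucas_cubic T K"
  shows "lucas_cubic T = K"
  unfolding lucas_cubic_def
proof (rule the_equality)
  show "is_lucas_cubic T K" by (rule assms)
  show "K' = K" if "is_lucas_cubic T K'" for K' using that assms by (rule is_lucas_cubic_unique)
qed

text \<open>Isotomic conjugation multiplies the form by \<open>- (x * y * z)\<close>, so the
  Gergonne point inherits membership from the Nagel point.\<close>

lemma lucas_form_side_points:
  fixes a b c :: real
  defines "x \<equiv> b + c - a" and "y \<equiv> c + a - b" and "z \<equiv> a + b - c"
    and "p \<equiv> b\<^sup>2 + c\<^sup>2 - a\<^sup>2" and "q \<equiv> c\<^sup>2 + a\<^sup>2 - b\<^sup>2" and "r \<equiv> a\<^sup>2 + b\<^sup>2 - c\<^sup>2"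
  shows "lucas_form p q r x y z = 0" "lucas_form p q r (y * z) (z * x) (x * y) = 0"
proof -
  show nagel: "lucas_form p q r x y z = 0"
    unfolding lucas_form_def x_def y_def z_def p_def q_def r_def
    by (simp add: power2_eq_square algebra_simps)
  have "lucas_form p q r (y * z) (z * x) (x * y) = - (x * y * z) * lucas_form p q r x y z"
    unfolding lucas_form_def by (simp add: power2_eq_square algebra_simps)
  then show "lucas_form p q r (y * z) (z * x) (x * y) = 0" using nagel by simp
qed

text \<open>Respectively the pivot, its isotomic conjugate (the orthocenter of the medial triangle),
  and the orthocenter of \<open>ABC\<close> in medial weights.\<close>

lemma lucas_form_angle_points:
  "lucas_form p q r p q r = 0" "lucas_form p q r (q * r) (r * p) (p * q) = 0"
  "lucas_form p q r (r * p + p * q - q * r) (p * q + q * r - r * p) (q * r + r * p - p * q) = 0"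
  by (simp_all add: lucas_form_def power2_eq_square algebra_simps)

theorem theorem6:
  fixes A B C :: point and K :: "point set"
  assumes "\<not> collinear {A, B, C}"
    and "K = lucas_cubic (medial_triangle (A, B, C))"
  shows "lemoine_point (A, B, C) \<in> K \<and> centroid (A, B, C) \<in> K \<and>
    circumcenter (A, B, C) \<in> K \<and> mittenpunkt (A, B, C) \<in> K \<and>
    incenter (A, B, C) \<in> K \<and> orthocenter (A, B, C) \<in> K \<and>
    A \<in> K \<and> B \<in> K \<and> C \<in> K \<and>
    midpoint B C \<in> K \<and> midpoint C A \<in> K \<and> midpoint A B \<in> K"
proof -
  have S: "signed_area A B C \<noteq> 0" using assms(1) by (simp add: collinear_iff_signed_area)
  define D E F where "D = midpoint B C" and "E = midpoint C A" and "F = midpoint A B"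
  have T: "medial_triangle (A, B, C) = (D, E, F)" unfolding D_def E_def F_def by simp
  have S': "signed_area D E F \<noteq> 0" unfolding D_def E_def F_def signed_area_medial using S by simp
  define a b c where "a = dist B C" and "b = dist C A" and "c = dist A B"
  define x y z where "x = b + c - a" and "y = c + a - b" and "z = a + b - c"
  define p q r where "p = b\<^sup>2 + c\<^sup>2 - a\<^sup>2" and "q = c\<^sup>2 + a\<^sup>2 - b\<^sup>2" and "r = a\<^sup>2 + b\<^sup>2 - c\<^sup>2"
  have pos: "a > 0" "b > 0" "c > 0" "x > 0" "y > 0" "z > 0"
    using triangle_ineqs[OF S] unfolding x_def y_def z_def a_def b_def c_def by simp_all
  have sides: "dist E F = a / 2" "dist F D = b / 2" "dist D E = c / 2"
    unfolding D_def E_def F_def a_def b_def c_def by (rule dist_medial)+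
  have to_medial: "bary_point (A, B, C) u v w = bary_point (D, E, F) (v + w - u) (w + u - v) (u + v - w)"
    for u v w
    unfolding T[symmetric] by (rule bary_point_eq_medial)
  have L: "lemoine_point (A, B, C) = bary_point (D, E, F) p q r"
    using lemoine_point_eq[OF S] unfolding to_medial p_def q_def r_def a_def b_def c_def .
  \<comment> \<open>One of \<open>p\<close>, \<open>q\<close>, \<open>r\<close> is negative in an
    obtuse triangle; only these combinations are positive, namely \<open>a^2 + b^2 + c^2\<close>,
    \<open>2 a^2\<close> and 16 times the squared area.\<close>
  have pqr: "p + q + r > 0" "q + r > 0" "q * r + r * p + p * q > 0"
    using orthocenter_eq(1)[OF S] pos unfolding p_def q_def r_def a_def b_def c_def
    by (simp_all add: add_pos_pos)
  define M where "M = {P. projectively_collinear (barycentric (D, E, F) P)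
      (isotomic (barycentric (D, E, F) P)) (barycentric (D, E, F) (lemoine_point (A, B, C)))}"
  have mem: "bary_point (D, E, F) u v w \<in> M" if "lucas_form p q r u v w = 0" "u + v + w \<noteq> 0" for u v w
    unfolding M_def mem_Collect_eq L
    using that pqr projectively_collinear_bary_point[OF S', of u v w p q r] by simp
  have points: "D \<in> M" "E \<in> M" "F \<in> M"
    using mem[of 1 0 0] mem[of 0 1 0] mem[of 0 0 1] by (simp_all add: bary_point_vertex lucas_form_def)
  \<comment> \<open>In medial weights \<open>A\<close> is \<open>-1 : 1 : 1\<close>; equal squares
    make the form vanish.\<close>
  have vertices: "A \<in> M" "B \<in> M" "C \<in> M"
    using mem[of "- 1" 1 1] mem[of 1 "- 1" 1] mem[of 1 1 "- 1"]
      to_medial[of 1 0 0] to_medial[of 0 1 0] to_medial[of 0 0 1]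
    by (simp_all add: bary_point_vertex lucas_form_def)
  have lemoine: "lemoine_point (A, B, C) \<in> M"
    unfolding L using pqr by (intro mem) (simp_all add: lucas_form_angle_points)
  have centroid: "centroid (D, E, F) \<in> M" "centroid (A, B, C) \<in> M"
    unfolding centroid_eq to_medial by (rule mem; simp add: lucas_form_def)+
  have quarter: "(b / 2)\<^sup>2 + (c / 2)\<^sup>2 - (a / 2)\<^sup>2 = 1 / 4 * p"
    "(c / 2)\<^sup>2 + (a / 2)\<^sup>2 - (b / 2)\<^sup>2 = 1 / 4 * q" "(a / 2)\<^sup>2 + (b / 2)\<^sup>2 - (c / 2)\<^sup>2 = 1 / 4 * r"
    unfolding p_def q_def r_def by (simp_all add: power_divide)
  have "orthocenter (D, E, F) = bary_point (D, E, F) (q * r) (r * p) (p * q)"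
    \<comment> \<open>Halved sides give a factor 1/4 in each of \<open>p\<close>, \<open>q\<close>,
      \<open>r\<close>, hence 1/16 in their products.\<close>
    using bary_point_scale[of "1 / 16" "(D, E, F)" "q * r" "r * p" "p * q"]
    unfolding orthocenter_eq(2)[OF S'] sides quarter by simp
  then have orthocenter_medial: "orthocenter (D, E, F) \<in> M"
    using mem pqr lucas_form_angle_points(2) by simp
  have nagel: "bary_point (D, E, F) x y z \<in> M"
    by (rule mem) (use pos lucas_form_side_points(1)[of b c a] in \<open>simp_all add: x_def y_def z_def p_def q_def r_def\<close>)
  have gergonne: "bary_point (D, E, F) (y * z) (z * x) (x * y) \<in> M"
  proof (rule mem)
    show "lucas_form p q r (y * z) (z * x) (x * y) = 0"
      unfolding x_def y_def z_def p_def q_def r_def by (rule lucas_form_side_points)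
    have "y * z + z * x + x * y > 0" using pos by (simp add: add_pos_pos)
    then show "y * z + z * x + x * y \<noteq> 0" by simp
  qed
  have half: "b / 2 + c / 2 - a / 2 = 1 / 2 * x" "c / 2 + a / 2 - b / 2 = 1 / 2 * y" "a / 2 + b / 2 - c / 2 = 1 / 2 * z"
    unfolding x_def y_def z_def by simp_all
  have "nagel_point (D, E, F) = bary_point (D, E, F) x y z"
    unfolding nagel_point_eq[OF S'] sides half by (rule bary_point_scale) simp
  then have nagel_medial: "nagel_point (D, E, F) \<in> M" using nagel by simp
  have "gergonne_point (D, E, F) = bary_point (D, E, F) (y * z) (z * x) (x * y)"
    using bary_point_scale[of "1 / 4" "(D, E, F)" "y * z" "z * x" "x * y"]
    unfolding gergonne_point_eq[OF S'] sides half by simp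
  then have gergonne_medial: "gergonne_point (D, E, F) \<in> M" using gergonne by simp
  have anticomplementary: "anticomplementary_triangle (D, E, F) = (A, B, C)"
    unfolding T[symmetric] by (rule anticomplementary_medial)
  have "cubic_curve M"
    unfolding M_def
  proof (rule cubic_curve_lucas[OF S'])
    have k: "signed_area D E F / (p + q + r) \<noteq> 0" using S' pqr by simp
    have "p + q + r \<noteq> 0" using pqr by simp
    from barycentric_bary_point[OF this, of D E F]
    have "barycentric (D, E, F) (lemoine_point (A, B, C)) $ 2 +
        barycentric (D, E, F) (lemoine_point (A, B, C)) $ 3 = signed_area D E F / (p + q + r) * (q + r)"
      unfolding L by (simp only: vector_scaleR_component vector_3 real_scaleR_def distrib_left)
    then show "barycentric (D, E, F) (lemoine_point (A, B, C)) $ 2 +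
        barycentric (D, E, F) (lemoine_point (A, B, C)) $ 3 \<noteq> 0"
      using k pqr by (simp only: mult_eq_0_iff) simp
  qed
  moreover have "vertices (D, E, F) \<union> vertices (A, B, C) \<union>
      {orthocenter (D, E, F), gergonne_point (D, E, F), centroid (D, E, F), nagel_point (D, E, F),
       lemoine_point (A, B, C)} \<subseteq> M"
    unfolding vertices.simps
    using points vertices lemoine centroid orthocenter_medial nagel_medial gergonne_medial by blast
  \<comment> \<open>The locus clause is the definition of \<open>M\<close>, since the
    anticomplementary triangle is \<open>ABC\<close>.\<close>
  ultimately have "is_lucas_cubic (D, E, F) M"
    unfolding is_lucas_cubic_def anticomplementary using M_def by blast
  then have K: "K = M" using assms(2) lucas_cubic_eq unfolding T by blast
  have circumcenter: "circumcenter (A, B, C) \<in> M"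
    using orthocenter_medial unfolding circumcenter_eq_orthocenter_medial T .
  have incenter: "incenter (A, B, C) \<in> M"
    using nagel unfolding incenter_eq[OF S] to_medial x_def y_def z_def a_def b_def c_def .
  have "mittenpunkt (A, B, C) = bary_point (A, B, C) (a * x) (b * y) (c * z)"
    using mittenpunkt_eq[OF S] unfolding x_def y_def z_def a_def b_def c_def .
  \<comment> \<open>In medial weights the mittenpunkt becomes the Gergonne point of the medial
    triangle.\<close>
  also have "\<dots> = bary_point (D, E, F) (y * z) (z * x) (x * y)"
  proof -
    have "b * y + c * z - a * x = y * z" "c * z + a * x - b * y = z * x" "a * x + b * y - c * z = x * y"
      unfolding x_def y_def z_def by (simp_all add: algebra_simps)
    then show ?thesis unfolding to_medial by simp
  qed
  finally have mittenpunkt: "mittenpunkt (A, B, C) \<in> M" using gergonne by simp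
  have "orthocenter (A, B, C) = bary_point (A, B, C) (q * r) (r * p) (p * q)"
    using orthocenter_eq(2)[OF S] unfolding p_def q_def r_def a_def b_def c_def .
  also have "\<dots> \<in> M"
    unfolding to_medial using pqr by (intro mem lucas_form_angle_points(3)) (simp add: algebra_simps)
  finally have orthocenter: "orthocenter (A, B, C) \<in> M" .
  show ?thesis
    unfolding K
    using points vertices lemoine centroid circumcenter mittenpunkt incenter orthocenter
    unfolding D_def E_def F_def by blast
qed

end
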